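(* Let $k=2p^\alpha$ with $p$ a prime and $\alpha\ge 0$ an integer, let $m\ge 1$ be an integer, and let $n(2,k,m)$ be a positive integer with the following property: for every $n'\ge n(2,k,m)$ and every $m$ continuous sections $s_1,\dots,s_m$ of $\Sigma^2(\gamma_{n'}^k)$ over $G_{n'}^k$ there exists $V\in G_{n'}^k$ such that every $s_i(V)$, $i=1,\dots,m$, is a real multiple of $Q(\gamma_{n'}^k)(V)$. Let $n\ge n(2,k,m)$ and let $K_1,\dots,K_m$ be convex bodies in $\mathbb R^n$. Then there exists a $k$-dimensional linear subspace $L\subseteq\mathbb R^n$ such that for every $i=1,\dots,m$ the orthogonal projection of $K_i$ onto $L$ has a Euclidean ball (in $L$) as its John ellipsoid.
   Context: $G_n^k$ is the Grassmannian of $k$-dimensional linear subspaces of $\mathbb R^n$, and $\gamma_n^k$ is its canonical (tautological) vector bundle, whose fiber over $V$ is $V$. $\Sigma^2(\gamma_n^k)$ is its fiberwise symmetric square; a continuous section of it is regarded as a continuous assignment of a quadratic form on $V$ to every $V\in G_n^k$. $Q(\gamma_n^k)$ is a Riemannian metric on $\gamma_n^k$, here the one given by restricting the standard quadratic form $x_1^2+\dots+x_n^2$ to each $V$. A multiple may be by any real scalar, including zero. The paper establishes that an integer $n(2,k,m)$ with the stated property exists for every $k=2p^\alpha$ and $m\ge1$, and that for $k=4$, $m=1$ one can take $12$. A convex body is a compact convex set with nonempty interior. The John ellipsoid of a convex body in a finite-dimensional Euclidean space $L$ is the unique ellipsoid of maximal volume contained in it. *)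

theory Defs
  imports "HOL-Analysis.Analysis" "HOL-Library.Function_Algebras"
begin

text \<open>
  Since the dimension of the ambient space is quantified over, \<open>\<real>\<^sup>n\<close> is the space
  \<^const>\<open>Euclidean_space\<close> of sequences vanishing from index \<open>n\<close> on. The pointwise vector space
  structure on functions makes \<^const>\<open>subspace\<close>, \<^const>\<open>dim\<close>, \<^const>\<open>linear\<close> and
  \<^const>\<open>convex\<close> available for it.
\<close>

instantiation "fun" :: (type, real_vector) real_vector
begin

definition scaleR_fun :: "real \<Rightarrow> ('a \<Rightarrow> 'b) \<Rightarrow> 'a \<Rightarrow> 'b" where
  "scaleR_fun c f = (\<lambda>x. c *\<^sub>R f x)"

instance
  by standard (simp_all add: scaleR_fun_def fun_eq_iff scaleR_add_right scaleR_add_left)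

end

lemma scaleR_fun_apply [simp]: "(c *\<^sub>R f) x = c *\<^sub>R f x"
  by (simp add: scaleR_fun_def)

definition dot :: "nat \<Rightarrow> (nat \<Rightarrow> real) \<Rightarrow> (nat \<Rightarrow> real) \<Rightarrow> real" where
  "dot n x y = (\<Sum>i<n. x i * y i)"

definition orth_proj :: "nat \<Rightarrow> (nat \<Rightarrow> real) set \<Rightarrow> (nat \<Rightarrow> real) \<Rightarrow> nat \<Rightarrow> real" where
  "orth_proj n V x = (THE v. v \<in> V \<and> (\<forall>w\<in>V. dot n (x - v) w = 0))"

definition grassmannian :: "nat \<Rightarrow> nat \<Rightarrow> (nat \<Rightarrow> real) set set" where
  "grassmannian n k = {V. subspace V \<and> V \<subseteq> topspace (Euclidean_space n) \<and> dim V = k}"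

text \<open>
  The usual topology of the Grassmannian: a subspace is identified with the orthogonal projector
  onto it. The topology of function types is that of pointwise convergence, which for linear maps
  on \<open>\<real>\<^sup>n\<close> (and below for quadratic forms on \<open>\<real>\<^sup>n\<close>) is convergence of the coefficients.
\<close>

definition grassmann_topology :: "nat \<Rightarrow> nat \<Rightarrow> (nat \<Rightarrow> real) set topology" where
  "grassmann_topology n k = pullback_topology (grassmannian n k) (orth_proj n) euclidean"

text \<open>
  Quadratic forms on \<open>V\<close> are functions on \<open>V\<close>, with the value \<^const>\<open>undefined\<close> outside. It is no
  restriction that the bilinear form is defined on the whole type, as every bilinear form
  on a subspace extends.
\<close>

definition quadratic_forms :: "(nat \<Rightarrow> real) set \<Rightarrow> ((nat \<Rightarrow> real) \<Rightarrow> real) set" where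
  "quadratic_forms V =
     {q \<in> extensional V. \<exists>b. bilinear b \<and> (\<forall>x y. b x y = b y x) \<and> (\<forall>x\<in>V. q x = b x x)}"

text \<open>
  Total space of the bundle of quadratic forms on the fibres of the canonical bundle. Its
  topology is that of a subbundle of the trivial bundle of quadratic forms on \<open>\<real>\<^sup>n\<close>, a form
  \<open>q\<close> on \<open>V\<close> being identified with its pullback along the projection onto \<open>V\<close>.
\<close>

definition sym_square_bundle ::
    "nat \<Rightarrow> nat \<Rightarrow> ((nat \<Rightarrow> real) set \<times> ((nat \<Rightarrow> real) \<Rightarrow> real)) topology" where
  "sym_square_bundle n k =
     pullback_topology (SIGMA V:grassmannian n k. quadratic_forms V)
       (\<lambda>(V, q). (orth_proj n V, q \<circ> orth_proj n V)) euclidean"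

definition continuous_section ::
    "nat \<Rightarrow> nat \<Rightarrow> ((nat \<Rightarrow> real) set \<Rightarrow> (nat \<Rightarrow> real) \<Rightarrow> real) \<Rightarrow> bool" where
  "continuous_section n k s \<longleftrightarrow>
     continuous_map (grassmann_topology n k) (sym_square_bundle n k) (\<lambda>V. (V, s V))"

definition std_form :: "nat \<Rightarrow> (nat \<Rightarrow> real) set \<Rightarrow> (nat \<Rightarrow> real) \<Rightarrow> real" where
  "std_form n V = (\<lambda>x\<in>V. \<Sum>i<n. (x i)\<^sup>2)"

definition section_bound :: "nat \<Rightarrow> nat \<Rightarrow> nat \<Rightarrow> bool" where
  "section_bound k m N \<longleftrightarrow>
     (\<forall>n\<ge>N. \<forall>s. (\<forall>i\<in>{1..m}. continuous_section n k (s i)) \<longrightarrow>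
        (\<exists>V\<in>grassmannian n k. \<forall>i\<in>{1..m}. \<exists>c. \<forall>x\<in>V. s i V x = c * std_form n V x))"

definition convex_body :: "nat \<Rightarrow> (nat \<Rightarrow> real) set \<Rightarrow> bool" where
  "convex_body n K \<longleftrightarrow>
     compactin (Euclidean_space n) K \<and> convex K \<and> Euclidean_space n interior_of K \<noteq> {}"

definition euclidean_ball_in :: "nat \<Rightarrow> (nat \<Rightarrow> real) set \<Rightarrow> (nat \<Rightarrow> real) set \<Rightarrow> bool" where
  "euclidean_ball_in n L E \<longleftrightarrow>
     (\<exists>c\<in>L. \<exists>r>0. E = {x \<in> L. sqrt (dot n (x - c) (x - c)) \<le> r})"

definition ellipsoid_in :: "nat \<Rightarrow> (nat \<Rightarrow> real) set \<Rightarrow> (nat \<Rightarrow> real) set \<Rightarrow> bool" where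
  "ellipsoid_in n L E \<longleftrightarrow>
     (\<exists>T. \<exists>c\<in>L. linear T \<and> bij_betw T L L \<and>
        E = (\<lambda>x. c + T x) ` {x \<in> L. sqrt (dot n x x) \<le> 1})"

text \<open>
  The \<open>k\<close>-dimensional Lebesgue measure on a \<open>k\<close>-dimensional subspace \<open>L\<close>, where \<open>k = CARD('k)\<close>,
  transported from \<open>real ^ 'k\<close> by a linear isometry onto \<open>L\<close>; it does not depend on the choice of
  the isometry.
\<close>

definition subspace_volume ::
    "'k::finite itself \<Rightarrow> nat \<Rightarrow> (nat \<Rightarrow> real) set \<Rightarrow> (nat \<Rightarrow> real) set \<Rightarrow> real" where
  "subspace_volume _ n L S =
     measure lebesgue
       ((SOME f :: real ^ 'k \<Rightarrow> nat \<Rightarrow> real.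
           linear f \<and> range f = L \<and> (\<forall>u v. dot n (f u) (f v) = u \<bullet> v)) -` S)"

definition max_volume_ellipsoid ::
    "'k::finite itself \<Rightarrow> nat \<Rightarrow> (nat \<Rightarrow> real) set \<Rightarrow> (nat \<Rightarrow> real) set \<Rightarrow> (nat \<Rightarrow> real) set \<Rightarrow> bool"
  where
  "max_volume_ellipsoid k n L C E \<longleftrightarrow>
     ellipsoid_in n L E \<and> E \<subseteq> C \<and>
     (\<forall>E'. ellipsoid_in n L E' \<and> E' \<subseteq> C \<longrightarrow> subspace_volume k n L E' \<le> subspace_volume k n L E)"

definition john_ellipsoid ::
    "'k::finite itself \<Rightarrow> nat \<Rightarrow> (nat \<Rightarrow> real) set \<Rightarrow> (nat \<Rightarrow> real) set \<Rightarrow> (nat \<Rightarrow> real) set \<Rightarrow> bool"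
  where
  "john_ellipsoid k n L C E \<longleftrightarrow>
     max_volume_ellipsoid k n L C E \<and> (\<forall>E'. max_volume_ellipsoid k n L C E' \<longrightarrow> E' = E)"

end

theory Submission
  imports Defs
begin

text \<open>
  The John ellipsoid of the projection of \<open>K\<^sub>i\<close> onto \<open>V\<close>, moved to the origin, is the unit ball
  of a positive definite quadratic form on \<open>V\<close>. These forms make up a continuous section, since the
  maximal ellipsoid is unique and hence, by compactness, depends continuously on the body. At the
  subspace supplied by the hypothesis all the forms are multiples of the Euclidean one, which means
  that the ellipsoids are balls.

  In coordinates an ellipsoid is \<open>c + A B\<close> with \<open>B\<close> the unit ball, and its volume is proportional
  to \<open>\<bar>det A\<bar>\<close>. For uniqueness, \<open>A\<close> and \<open>A S\<close> being optimal, replace \<open>S\<close> by the positive definite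
  factor \<open>S U\<close> of its polar decomposition: the ellipsoid given by \<open>(A + A S U) / 2\<close> still fits, and
  its determinant is larger than \<open>det A\<close> unless \<open>S\<close> is orthogonal.
\<close>

subsection \<open>Diagonalization of symmetric matrices\<close>

text \<open>Two ambiguities stand in the way of continuity. The matrix of a maximal ellipsoid is
  determined only up to a rotation on the right, and orthonormal frames of the subspaces cannot in
  general be chosen continuously over the whole Grassmannian. The object that is followed is
  therefore \<open>ellipsoid_form\<close>, which does not see rotations of the matrix, and
  convergence is tested near one subspace at a time. The compactness argument has two unequal
  halves. That a limit of ellipsoids in nearby bodies lies in the limit body needs only closedness.
  That it has maximal volume there requires every ellipsoid in the limit body to be almost realised
  in the nearby bodies, and this is where convexity and an interior ball enter. Uniqueness must
  cover the centre as well: the convex hull of two distinct translates of an ellipsoid contains a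
  larger one, stretched along the displacement.\<close>

definition diag_mat :: "('n \<Rightarrow> real) \<Rightarrow> real^'n^'n" where
  "diag_mat d = (\<chi> i j. if i = j then d i else 0)"

lemma diag_mat_mult: "diag_mat d ** diag_mat e = diag_mat (\<lambda>i. d i * e i)"
proof -
  have "(\<Sum>k\<in>UNIV. (if i = k then d i else 0) * (if k = j then e k else 0))
      = (\<Sum>k\<in>UNIV. if k = i then (if i = j then d i * e i else 0) else 0)" for i j
    by (rule sum.cong) auto
  then show ?thesis
    by (simp add: diag_mat_def matrix_matrix_mult_def vec_eq_iff)
qed

lemma det_diag_mat: "det (diag_mat d) = prod d UNIV"
  by (subst det_diagonal) (auto simp: diag_mat_def)

lemma mult_diag_mat_component: "(A ** diag_mat d) $ i $ j = A $ i $ j * d j"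
  by (simp add: diag_mat_def matrix_matrix_mult_def mult_delta_right)

lemma diag_mat_mult_vec: "(diag_mat d *v x) $ i = d i * x $ i"
  by (simp add: diag_mat_def matrix_vector_mult_def mult_delta_left)

lemma transpose_diag_mat: "transpose (diag_mat d) = diag_mat d"
  by (simp add: diag_mat_def transpose_def vec_eq_iff)

lemma diag_mat_1: "diag_mat (\<lambda>_. 1) = mat 1"
  by (simp add: diag_mat_def mat_def)

text \<open>For small t a nonzero linear term would dominate the quadratic one. This is the
  first-order condition at a maximum, freed of derivatives.\<close>

lemma eq_0_if_linear_le_quadratic:
  fixes a b :: real
  assumes "\<And>t. 2 * t * a \<le> t\<^sup>2 * b"
  shows "a = 0"
proof (rule ccontr)
  assume "a \<noteq> 0"
  \<comment> \<open>The test value t = a / (|b| + 1) is small enough for the linear term to win; the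
    summand 1 keeps the denominator positive when b = 0.\<close>
  have "2 * (a / (\<bar>b\<bar> + 1)) * a * (\<bar>b\<bar> + 1)\<^sup>2 \<le> (a / (\<bar>b\<bar> + 1))\<^sup>2 * b * (\<bar>b\<bar> + 1)\<^sup>2"
    by (rule mult_right_mono[OF assms]) auto
  also have "(a / (\<bar>b\<bar> + 1))\<^sup>2 * b * (\<bar>b\<bar> + 1)\<^sup>2 = a\<^sup>2 * b"
    by (simp add: power_divide)
  also have "2 * (a / (\<bar>b\<bar> + 1)) * a * (\<bar>b\<bar> + 1)\<^sup>2 = a\<^sup>2 * (2 * (\<bar>b\<bar> + 1))"
    by (simp add: power2_eq_square)
  finally have "2 * (\<bar>b\<bar> + 1) \<le> b"
    using \<open>a \<noteq> 0\<close> by simp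
  then show False by (simp add: algebra_simps)
qed

lemma inner_symmetric_matrix:
  fixes M :: "real^'n^'n"
  assumes "transpose M = M"
  shows "x \<bullet> (M *v y) = (M *v x) \<bullet> y"
  using dot_lmul_matrix[of x M y] transpose_matrix_vector[of M x] assms by simp

text \<open>Maximise the Rayleigh quotient on the unit sphere of the orthogonal complement of
  \<open>B\<close>. As \<open>B\<close> consists of eigenvectors, the symmetric \<open>M\<close>
  maps this complement to itself, so the constrained maximiser is an eigenvector of \<open>M\<close>
  and not merely of its compression.\<close>

lemma symmetric_eigenvector_orthogonal:
  fixes M :: "real^'n^'n"
  assumes sym: "transpose M = M"
    and eig: "\<And>b. b \<in> B \<Longrightarrow> \<exists>\<mu>. M *v b = \<mu> *\<^sub>R b"
    and small: "dim B < CARD('n)"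
  obtains x \<mu> where "norm x = 1" "\<And>b. b \<in> B \<Longrightarrow> orthogonal b x" "M *v x = \<mu> *\<^sub>R x"
proof -
  define W where "W = {x. \<forall>b\<in>B. b \<bullet> x = 0}"
  have sub: "subspace W"
    by (auto simp: W_def subspace_def inner_add_right)
  have "closed W"
    using sub by (rule closed_subspace)
  then have cW: "compact (sphere 0 1 \<inter> W)"
    by (simp add: compact_Int_closed)
  obtain z where z: "z \<noteq> 0" "\<And>b. b \<in> span B \<Longrightarrow> orthogonal z b"
    using orthogonal_to_subspace_exists[of B] small by auto
  then have "z \<in> W"
    by (auto simp: W_def orthogonal_def inner_commute span_base)
  then have "z /\<^sub>R norm z \<in> sphere 0 1 \<inter> W"
    using z sub by (simp add: subspace_scale)
  then have ne: "sphere 0 1 \<inter> W \<noteq> {}" by blast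
  have cont: "continuous_on (sphere 0 1 \<inter> W) (\<lambda>x. x \<bullet> (M *v x))"
    by (intro continuous_intros matrix_vector_mult_linear_continuous_on)
  obtain x where x: "x \<in> sphere 0 1 \<inter> W"
    and max: "\<And>y. y \<in> sphere 0 1 \<inter> W \<Longrightarrow> y \<bullet> (M *v y) \<le> x \<bullet> (M *v x)"
    using continuous_attains_sup[OF cW ne cont] by blast
  define \<mu> where "\<mu> = x \<bullet> (M *v x)"
  have maxW: "w \<bullet> (M *v w) \<le> \<mu> * (w \<bullet> w)" if "w \<in> W" for w
  proof (cases "w = 0")
    case False
    then have "w /\<^sub>R norm w \<in> sphere 0 1 \<inter> W"
      using that sub by (simp add: subspace_scale)
    from max[OF this] show ?thesis
      using False
      by (simp add: \<mu>_def matrix_vector_mult_scaleR power2_norm_eq_inner[symmetric] field_simps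
          power2_eq_square)
  qed simp
  have xx: "x \<bullet> x = 1" and xW: "x \<in> W"
    using x by (auto simp: norm_eq_1)
  \<comment> \<open>The residual lies in \<open>W\<close>, so \<open>x\<close> may be varied along
    it within the constraint; stationarity in exactly this direction makes the residual
    vanish.\<close>
  define y where "y = M *v x - \<mu> *\<^sub>R x"
  have "b \<bullet> y = 0" if "b \<in> B" for b
  proof -
    have "b \<bullet> x = 0" using xW that by (simp add: W_def)
    moreover obtain \<nu> where "M *v b = \<nu> *\<^sub>R b" using eig \<open>b \<in> B\<close> by blast
    ultimately show ?thesis
      by (simp add: y_def inner_diff_right inner_symmetric_matrix[OF sym])
  qed
  then have yW: "y \<in> W" by (simp add: W_def)
  have "y \<bullet> y = 0"
  proof (rule eq_0_if_linear_le_quadratic)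
    fix t :: real
    have "x + t *\<^sub>R y \<in> W"
      using xW yW sub by (simp add: subspace_add subspace_scale)
    from maxW[OF this]
    have "\<mu> + 2 * t * (y \<bullet> (M *v x)) + t\<^sup>2 * (y \<bullet> (M *v y)) \<le> \<mu> * (1 + 2 * t * (x \<bullet> y) + t\<^sup>2 * (y \<bullet> y))"
      using xx inner_symmetric_matrix[OF sym, of x y]
      by (simp add: \<mu>_def[symmetric] matrix_vector_right_distrib matrix_vector_mult_scaleR inner_add_left
          inner_add_right algebra_simps power2_eq_square inner_commute)
    moreover have "y \<bullet> y = y \<bullet> (M *v x) - \<mu> * (x \<bullet> y)"
      using inner_diff_right[of y "M *v x" "\<mu> *\<^sub>R x"] by (simp add: y_def[symmetric] inner_commute)
    ultimately have "2 * t * (y \<bullet> y + \<mu> * (x \<bullet> y)) + t\<^sup>2 * (y \<bullet> (M *v y))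
        \<le> \<mu> * (2 * t * (x \<bullet> y) + t\<^sup>2 * (y \<bullet> y))"
      by (simp add: distrib_left)
    then show "2 * t * (y \<bullet> y) \<le> t\<^sup>2 * (\<mu> * (y \<bullet> y) - y \<bullet> (M *v y))"
      by (simp add: algebra_simps)
  qed
  then have "M *v x = \<mu> *\<^sub>R x" by (simp add: y_def)
  moreover have "orthogonal b x" if "b \<in> B" for b
    using xW that by (simp add: W_def orthogonal_def)
  ultimately show ?thesis using that x by auto
qed

text \<open>A largest orthonormal set of eigenvectors must be a basis, since
  \<open>symmetric_eigenvector_orthogonal\<close> would otherwise enlarge it; independence bounds
  the sizes.\<close>

lemma symmetric_orthonormal_eigenbasis:
  fixes M :: "real^'n^'n"
  assumes sym: "transpose M = M"
  obtains B where "pairwise orthogonal B" "\<And>b. b \<in> B \<Longrightarrow> norm b = 1"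
    "\<And>b. b \<in> B \<Longrightarrow> \<exists>\<mu>. M *v b = \<mu> *\<^sub>R b" "finite B" "card B = CARD('n)"
proof -
  define P where "P B \<longleftrightarrow> pairwise orthogonal B \<and> (\<forall>b\<in>B. norm b = 1 \<and> (\<exists>\<mu>. M *v b = \<mu> *\<^sub>R b))"
    for B
  have indep: "independent B" if "P B" for B
    using that pairwise_orthogonal_independent[of B] by (force simp: P_def)
  have bound: "finite B \<and> card B \<le> CARD('n)" if "P B" for B
    using independent_bound[OF indep[OF that]] by simp
  have "P {}" by (simp add: P_def)
  moreover have "\<forall>C. P C \<longrightarrow> card C < Suc (CARD('n))"
    using bound by (auto simp: less_Suc_eq_le)
  ultimately obtain B where B: "P B" and maxB: "\<And>C. P C \<Longrightarrow> card C \<le> card B"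
    using ex_has_greatest_nat[of P "{}" card "Suc (CARD('n))"] by blast
  have "card B = CARD('n)"
  proof (rule ccontr)
    assume "card B \<noteq> CARD('n)"
    then have "dim B < CARD('n)"
      using bound[OF B] dim_le_card'[of B] by simp
    then obtain x \<mu> where x: "norm x = 1" "\<And>b. b \<in> B \<Longrightarrow> orthogonal b x" "M *v x = \<mu> *\<^sub>R x"
      using symmetric_eigenvector_orthogonal[OF sym, of B] B unfolding P_def by blast
    then have "x \<notin> B"
      using orthogonal_self[of x] by fastforce
    moreover have "P (insert x B)"
      using B x by (auto simp: P_def pairwise_insert orthogonal_commute)
    ultimately show False
      using maxB[of "insert x B"] bound[OF B] by simp
  qed
  then show ?thesis
    using B bound that unfolding P_def by blast
qed

lemma symmetric_matrix_diagonalization: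
  fixes M :: "real^'n^'n"
  assumes sym: "transpose M = M"
  obtains Q d where "orthogonal_matrix Q" "M = Q ** diag_mat d ** transpose Q"
proof -
  obtain B where B: "pairwise orthogonal B" "\<And>b. b \<in> B \<Longrightarrow> norm b = 1"
    "\<And>b. b \<in> B \<Longrightarrow> \<exists>\<mu>. M *v b = \<mu> *\<^sub>R b" "finite B" "card B = CARD('n)"
    by (rule symmetric_orthonormal_eigenbasis[OF sym]) (rule that)
  obtain h where h: "bij_betw h (UNIV :: 'n set) B"
    using B finite_same_card_bij[of "UNIV :: 'n set" B] by auto
  have "\<exists>\<mu>. M *v h j = \<mu> *\<^sub>R h j" for j
    using B(3) h by (auto simp: bij_betw_def)
  then obtain d where d: "\<And>j. M *v h j = d j *\<^sub>R h j" by metis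
  define Q where "Q = (\<chi> i j. h j $ i)"
  have col: "column j Q = h j" for j
    by (simp add: column_def Q_def vec_eq_iff)
  have Q: "orthogonal_matrix Q"
    unfolding orthogonal_matrix_orthonormal_columns col
    using h B(1,2) by (fastforce simp: bij_betw_def pairwise_def inj_on_def)
  have "(M ** Q) $ i $ j = (Q ** diag_mat d) $ i $ j" for i j
  proof -
    have "(M ** Q) $ i $ j = (M *v h j) $ i"
      by (simp add: matrix_matrix_mult_def matrix_vector_mult_def Q_def)
    then show ?thesis
      by (simp add: d mult_diag_mat_component Q_def mult.commute)
  qed
  then have "M ** Q = Q ** diag_mat d" by (simp add: vec_eq_iff)
  then have "M ** (Q ** transpose Q) = Q ** diag_mat d ** transpose Q"
    by (simp add: matrix_mul_assoc)
  with Q have "M = Q ** diag_mat d ** transpose Q"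
    by (simp add: orthogonal_matrix_def)
  with Q that show ?thesis by blast
qed

text \<open>Take roots of the eigenvalues. The root is delivered in diagonalized form, from which
  its symmetry and its determinant can be read off.\<close>

lemma positive_matrix_sqrt:
  fixes M :: "real^'n^'n"
  assumes sym: "transpose M = M" and pos: "\<And>x. x \<noteq> 0 \<Longrightarrow> x \<bullet> (M *v x) > 0"
  obtains Q d where "orthogonal_matrix Q" "\<And>i. d i > 0"
    "M = (Q ** diag_mat d ** transpose Q) ** (Q ** diag_mat d ** transpose Q)"
proof -
  obtain Q d where Q: "orthogonal_matrix Q" and M: "M = Q ** diag_mat d ** transpose Q"
    by (rule symmetric_matrix_diagonalization[OF sym]) (rule that)
  have QQ: "transpose Q ** Q = mat 1" using Q by (simp add: orthogonal_matrix_def)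
  have d: "d i > 0" for i
  proof -
    \<comment> \<open>The i-th column of \<open>Q\<close> is an eigenvector for \<open>d i\<close>,
      and the form takes the value \<open>d i\<close> on it.\<close>
    define x where "x = Q *v axis i 1"
    have tx: "transpose Q *v x = axis i 1"
      by (simp add: x_def matrix_vector_mul_assoc QQ)
    have "x \<noteq> 0" using tx by (auto simp: axis_eq_0_iff)
    then have "0 < x \<bullet> (Q *v (diag_mat d *v (transpose Q *v x)))"
      using pos[of x] by (simp add: M matrix_vector_mul_assoc matrix_mul_assoc del: transpose_matrix_vector)
    also have "\<dots> = (transpose Q *v x) \<bullet> (diag_mat d *v (transpose Q *v x))"
      by (simp add: dot_lmul_matrix)
    also have "\<dots> = d i"
      by (simp only: tx) (simp add: inner_axis' diag_mat_mult_vec)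
    finally show ?thesis .
  qed
  define e where "e = (\<lambda>i. sqrt (d i))"
  have "(Q ** diag_mat e ** transpose Q) ** (Q ** diag_mat e ** transpose Q)
      = Q ** diag_mat e ** (transpose Q ** Q) ** diag_mat e ** transpose Q"
    by (simp add: matrix_mul_assoc)
  also have "\<dots> = Q ** (diag_mat e ** diag_mat e) ** transpose Q"
    by (simp add: QQ matrix_mul_assoc)
  also have "diag_mat e ** diag_mat e = diag_mat d"
    using d by (simp add: diag_mat_mult e_def less_imp_le)
  finally show ?thesis
    using Q M d by (intro that[of Q e]) (auto simp: e_def)
qed

subsection \<open>Uniqueness of the maximal ellipsoid\<close>

lemma obtain_matrix_inverse:
  fixes A :: "real^'n^'n"
  assumes "det A \<noteq> 0"
  obtains B where "A ** B = mat 1" "B ** A = mat 1"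
  using assms unfolding invertible_det_nz[symmetric] invertible_def by blast

lemma norm_orthogonal_matrix_mult:
  fixes U :: "real^'n^'n"
  assumes "orthogonal_matrix U"
  shows "norm (U *v x) = norm x"
  using assms orthogonal_transformation_matrix[of "(*v) U"]
  by (simp add: orthogonal_transformation_norm)

lemma det_scaleR: "det (r *\<^sub>R A) = r ^ CARD('n) * det A" for A :: "real^'n^'n"
proof -
  have "r *\<^sub>R A = A ** diag_mat (\<lambda>_. r)"
    by (simp add: vec_eq_iff mult_diag_mat_component)
  then show ?thesis by (simp add: det_mul det_diag_mat)
qed

lemma matrix_mult_add_right: "(A + B) ** C = A ** C + B ** C" for A :: "real^'n^'m"
  by (simp add: matrix_matrix_mult_def vec_eq_iff distrib_right sum.distrib)

text \<open>Let P be the positive square root of S times its transpose; then the inverse of S times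
  P is orthogonal and serves as U. The rotation stands on the right because right factors do not
  change an ellipsoid.\<close>

lemma right_polar_decomposition:
  fixes S :: "real^'n^'n"
  assumes "det S \<noteq> 0"
  obtains U Q d where "orthogonal_matrix U" "orthogonal_matrix Q" "\<And>i. d i > 0"
    "S ** U = Q ** diag_mat d ** transpose Q"
proof -
  have "transpose (S ** transpose S) = S ** transpose S"
    by (simp add: matrix_transpose_mul)
  moreover have "x \<bullet> ((S ** transpose S) *v x) > 0" if "x \<noteq> 0" for x
  proof -
    have "transpose S *v x \<noteq> 0"
      using that assms invertible_det_nz[of "transpose S"]
        matrix_left_invertible_ker[of "transpose S"] invertible_left_inverse[of "transpose S"]
      by (auto simp del: transpose_matrix_vector)
    then show ?thesis
      by (simp add: matrix_vector_mul_assoc[symmetric] dot_lmul_matrix[symmetric])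
  qed
  ultimately obtain Q d where Q: "orthogonal_matrix Q" and d: "\<And>i. d i > 0"
    and P: "S ** transpose S = (Q ** diag_mat d ** transpose Q) ** (Q ** diag_mat d ** transpose Q)"
    by (rule positive_matrix_sqrt) blast+
  define P where "P = Q ** diag_mat d ** transpose Q"
  have symP: "transpose P = P"
    by (simp add: P_def matrix_transpose_mul transpose_diag_mat matrix_mul_assoc)
  obtain R where R: "S ** R = mat 1" "R ** S = mat 1"
    using obtain_matrix_inverse[OF assms] by blast
  have "(R ** P) ** transpose (R ** P) = R ** (P ** P) ** transpose R"
    by (simp add: matrix_transpose_mul symP matrix_mul_assoc)
  also have "P ** P = S ** transpose S"
    by (simp add: P P_def)
  also have "R ** (S ** transpose S) ** transpose R = (R ** S) ** transpose (R ** S)"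
    by (simp add: matrix_transpose_mul matrix_mul_assoc)
  finally have "(R ** P) ** transpose (R ** P) = mat 1"
    by (simp add: R)
  then have "orthogonal_matrix (R ** P)"
    by (simp add: orthogonal_matrix_def matrix_left_right_inverse)
  moreover have "S ** (R ** P) = P"
    by (simp add: matrix_mul_assoc R)
  ultimately show ?thesis
    using that Q d unfolding P_def by blast
qed

text \<open>The equality case of the inequality of arithmetic and geometric means: (1 + d)^2 is at
  least 4 d, with equality only at 1. The ratios \<open>g i\<close> are all at least 1 while their
  product is at most 1, so each of them is 1.\<close>

lemma prod_one_plus_le_imp_eq_one:
  fixes d :: "'n::finite \<Rightarrow> real"
  assumes pos: "\<And>i. d i > 0" and one: "prod d UNIV = 1"
    and le: "(\<Prod>i\<in>UNIV. 1 + d i) \<le> 2 ^ CARD('n)"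
  shows "d j = 1"
proof -
  define g where "g = (\<lambda>i. (1 + d i)\<^sup>2 / (4 * d i))"
  have g1: "g i \<ge> 1" for i
  proof -
    have "(1 + d i)\<^sup>2 - 4 * d i = (1 - d i)\<^sup>2"
      by (simp add: power2_eq_square algebra_simps)
    moreover have "(1 - d i)\<^sup>2 \<ge> 0" by simp
    ultimately have "(1 + d i)\<^sup>2 \<ge> 4 * d i" by linarith
    then show ?thesis using pos[of i] by (simp add: g_def)
  qed
  have "prod g UNIV = (\<Prod>i\<in>UNIV. 1 + d i)\<^sup>2 / 4 ^ CARD('n)"
    by (simp add: g_def prod_dividef prod.distrib one prod_power_distrib)
  also have "\<dots> \<le> (2 ^ CARD('n))\<^sup>2 / 4 ^ CARD('n)"
    using pos by (intro divide_right_mono power_mono le prod_nonneg) (auto simp: add_nonneg_nonneg less_imp_le)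
  also have "\<dots> = 1"
    by (simp add: power2_eq_square flip: power_mult_distrib)
  finally have "prod g UNIV \<le> 1" .
  moreover have "prod g UNIV = g j * prod g (UNIV - {j})"
    by (rule prod.remove) auto
  moreover have "prod g (UNIV - {j}) \<ge> 1"
    using g1 by (intro prod_ge_1) auto
  ultimately have "g j \<le> 1"
    using g1[of j] mult_left_mono[of 1 "prod g (UNIV - {j})" "g j"] by linarith
  then have "(1 + d j)\<^sup>2 \<le> 4 * d j"
    using pos[of j] by (simp add: g_def)
  then have "(1 - d j)\<^sup>2 \<le> 0"
    by (simp add: power2_eq_square algebra_simps)
  then show ?thesis by simp
qed

text \<open>The bound is used at the polar factor U of S. If \<open>d\<close> are the eigenvalues of
  S U, whose product is 1, it says that the product of the 1 + \<open>d i\<close> does not exceed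
  its least possible value, which forces S U = 1.\<close>

lemma orthogonal_matrix_if_det_sums_small:
  fixes S :: "real^'n^'n"
  assumes det: "\<bar>det S\<bar> = 1"
    and le: "\<And>U. orthogonal_matrix U \<Longrightarrow> \<bar>det (mat 1 + S ** U)\<bar> \<le> 2 ^ CARD('n)"
  shows "orthogonal_matrix S"
proof -
  have "det S \<noteq> 0" using det by auto
  then obtain U Q d where U: "orthogonal_matrix U" and Q: "orthogonal_matrix Q"
    and d: "\<And>i. d i > 0" and SU: "S ** U = Q ** diag_mat d ** transpose Q"
    by (rule right_polar_decomposition) blast
  have QQ: "Q ** transpose Q = mat 1" using Q by (simp add: orthogonal_matrix_def)
  have conj: "det (Q ** diag_mat e ** transpose Q) = prod e UNIV" for e
  proof -
    have "det Q * det (transpose Q) = 1"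
      using QQ by (metis det_I det_mul)
    then show ?thesis
      by (simp add: det_mul det_diag_mat)
  qed
  have "prod d UNIV = \<bar>prod d UNIV\<bar>"
    using d by (simp add: prod_nonneg less_imp_le)
  also have "\<dots> = \<bar>det (S ** U)\<bar>"
    by (simp add: SU conj)
  also have "\<dots> = 1"
    using det_orthogonal_matrix[OF U] det by (auto simp: det_mul abs_mult)
  finally have one: "prod d UNIV = 1" .
  have "mat 1 + S ** U = Q ** diag_mat (\<lambda>i. 1 + d i) ** transpose Q"
  proof -
    have "diag_mat (\<lambda>i. 1 + d i) = mat 1 + diag_mat d"
      by (simp add: diag_mat_def mat_def vec_eq_iff)
    then have "Q ** diag_mat (\<lambda>i. 1 + d i) ** transpose Q
        = Q ** transpose Q + Q ** diag_mat d ** transpose Q"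
      by (simp add: matrix_add_ldistrib matrix_mult_add_right)
    then show ?thesis by (simp add: QQ SU)
  qed
  then have "(\<Prod>i\<in>UNIV. 1 + d i) \<le> 2 ^ CARD('n)"
    using le[OF U] by (simp add: conj abs_le_iff)
  then have "d = (\<lambda>_. 1)"
    using prod_one_plus_le_imp_eq_one[OF d one] by blast
  then have "S ** U = mat 1"
    by (simp add: SU diag_mat_1 QQ)
  then have "S ** (U ** transpose U) = transpose U"
    by (simp add: matrix_mul_assoc)
  then have "S = transpose U"
    using U by (simp add: orthogonal_matrix_def)
  then show ?thesis using U by simp
qed

definition ellipsoid :: "real^'n \<Rightarrow> real^'n^'n \<Rightarrow> (real^'n) set" where
  "ellipsoid c A = (\<lambda>x. c + A *v x) ` cball 0 1"

definition max_ellipsoid :: "(real^'n) set \<Rightarrow> real^'n \<Rightarrow> real^'n^'n \<Rightarrow> bool" where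
  "max_ellipsoid C c A \<longleftrightarrow>
     ellipsoid c A \<subseteq> C \<and> (\<forall>c' A'. ellipsoid c' A' \<subseteq> C \<longrightarrow> \<bar>det A'\<bar> \<le> \<bar>det A\<bar>)"

lemma ellipsoid_subset_iff: "ellipsoid c A \<subseteq> C \<longleftrightarrow> (\<forall>x. norm x \<le> 1 \<longrightarrow> c + A *v x \<in> C)"
  by (auto simp: ellipsoid_def)

lemma ellipsoid_orthogonal_mult:
  assumes "orthogonal_matrix U"
  shows "ellipsoid c (A ** U) = ellipsoid c A"
proof -
  have sub: "ellipsoid c (A ** U) \<subseteq> ellipsoid c A" if "orthogonal_matrix U" for A U
    using that unfolding ellipsoid_subset_iff
    by (auto simp: ellipsoid_def norm_orthogonal_matrix_mult matrix_vector_mul_assoc[symmetric])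
  have "A ** U ** transpose U = A"
    using assms by (simp add: matrix_mul_assoc[symmetric] orthogonal_matrix_def)
  then show ?thesis
    using sub[OF assms, of A] sub[of "transpose U" "A ** U"] assms by simp
qed

text \<open>Conjugating a diagonal matrix by a rotation that carries a coordinate axis to u gives
  the identity plus t times the projector onto u. It serves to enlarge an ellipsoid in a single
  direction.\<close>

lemma stretch_matrix:
  fixes u :: "real^'n"
  assumes "norm u = 1"
  obtains T where "det T = 1 + t" "\<And>x. T *v x = x + (t * (u \<bullet> x)) *\<^sub>R u"
proof -
  fix k :: 'n
  obtain Q where Q: "orthogonal_matrix Q" and u: "Q *v axis k 1 = u"
    using orthogonal_matrix_exists_basis[OF assms] by blast
  have QQ: "Q ** transpose Q = mat 1" using Q by (simp add: orthogonal_matrix_def)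
  define d where "d = (\<lambda>i. if i = k then 1 + t else 1)"
  define T where "T = Q ** diag_mat d ** transpose Q"
  have "det Q * det (transpose Q) = 1"
    using QQ by (metis det_I det_mul)
  then have "det T = 1 + t"
    by (simp add: T_def det_mul det_diag_mat d_def)
  moreover have "T *v x = x + (t * (u \<bullet> x)) *\<^sub>R u" for x
  proof -
    have diag: "diag_mat d *v y = y + (t * y $ k) *\<^sub>R axis k 1" for y
      by (simp add: vec_eq_iff diag_mat_mult_vec d_def axis_def algebra_simps)
    have "(transpose Q *v x) $ k = x \<bullet> u"
      using dot_lmul_matrix[of x Q "axis k 1"] by (simp add: u inner_axis)
    then have "T *v x = Q *v (transpose Q *v x) + (t * (u \<bullet> x)) *\<^sub>R u"
      by (simp add: T_def matrix_vector_mul_assoc[symmetric] diag matrix_vector_right_distrib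
          matrix_vector_mult_scaleR u inner_commute del: transpose_matrix_vector)
    then show ?thesis
      by (simp add: matrix_vector_mul_assoc QQ del: transpose_matrix_vector)
  qed
  ultimately show ?thesis by (rule that)
qed

lemma max_ellipsoid_unique:
  fixes A A' :: "real^'n^'n"
  assumes C: "convex C" and max: "max_ellipsoid C c A" and max': "max_ellipsoid C c' A'"
    and det: "det A \<noteq> 0"
  obtains U where "c' = c" "orthogonal_matrix U" "A' = A ** U"
proof -
  obtain R where R: "A ** R = mat 1" "R ** A = mat 1"
    using obtain_matrix_inverse[OF det] by blast
  have in_C: "c + A *v x \<in> C" "c' + A' *v x \<in> C" if "norm x \<le> 1" for x
    using max max' that by (auto simp: max_ellipsoid_def ellipsoid_subset_iff)
  have bound: "\<bar>det B\<bar> \<le> \<bar>det A\<bar>" if "\<And>x. norm x \<le> 1 \<Longrightarrow> a + B *v x \<in> C" for a B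
    using max that unfolding max_ellipsoid_def ellipsoid_subset_iff by blast
  define S where "S = R ** A'"
  have A': "A' = A ** S" by (simp add: S_def matrix_mul_assoc R)
  have "\<bar>det A'\<bar> = \<bar>det A\<bar>"
    using max max' unfolding max_ellipsoid_def by (meson order_antisym)
  then have detS: "\<bar>det S\<bar> = 1"
    using det by (simp add: A' det_mul abs_mult)
  have S: "orthogonal_matrix S"
  proof (rule orthogonal_matrix_if_det_sums_small[OF detS])
    fix U :: "real^'n^'n" assume U: "orthogonal_matrix U"
    \<comment> \<open>The linear part of the average of c + A x and c' + A' U x. Both points lie in
      \<open>C\<close> for every x in the unit ball, whatever the rotation U.\<close>
    define B where "B = (1/2) *\<^sub>R (A ** (mat 1 + S ** U))"
    have "\<bar>det B\<bar> \<le> \<bar>det A\<bar>"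
    proof (rule bound)
      fix x :: "real^'n" assume x: "norm x \<le> 1"
      have "(1/2) *\<^sub>R (c + A *v x) + (1/2) *\<^sub>R (c' + A' *v (U *v x)) \<in> C"
        using x U by (intro convexD[OF C] in_C) (auto simp: norm_orthogonal_matrix_mult)
      also have "(1/2) *\<^sub>R (c + A *v x) + (1/2) *\<^sub>R (c' + A' *v (U *v x))
          = (1/2) *\<^sub>R (c + c') + B *v x"
        by (simp add: B_def A' scaleR_matrix_vector_assoc[symmetric] matrix_vector_mul_assoc[symmetric]
            matrix_vector_mult_add_rdistrib matrix_vector_right_distrib scaleR_add_right)
      finally show "(1/2) *\<^sub>R (c + c') + B *v x \<in> C" .
    qed
    moreover have "\<bar>det B\<bar> = \<bar>det A\<bar> * (\<bar>det (mat 1 + S ** U)\<bar> / 2 ^ CARD('n))"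
      by (simp add: B_def det_scaleR det_mul abs_mult power_one_over divide_simps)
    ultimately have "\<bar>det A\<bar> * (\<bar>det (mat 1 + S ** U)\<bar> / 2 ^ CARD('n)) \<le> \<bar>det A\<bar> * 1"
      by simp
    then have "\<bar>det (mat 1 + S ** U)\<bar> / 2 ^ CARD('n) \<le> 1"
      using det by (subst (asm) mult_le_cancel_left_pos) auto
    then show "\<bar>det (mat 1 + S ** U)\<bar> \<le> 2 ^ CARD('n)" by simp
  qed
  moreover have "c' = c"
  proof (rule ccontr)
    assume ne: "c' \<noteq> c"
    \<comment> \<open>\<open>v\<close> is the displacement of the centres in coordinates where the
      first ellipsoid is a unit ball. The second is then a unit ball too, and the hull of both
      contains the ball about the midpoint stretched by 1 + |v|/2 along \<open>v\<close>; this is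
      where \<open>t\<close> comes from.\<close>
    define v where "v = R *v (c' - c)"
    have Av: "A *v v = c' - c"
      by (simp add: v_def matrix_vector_mul_assoc R)
    then have "v \<noteq> 0" using ne by auto
    define t where "t = norm v / 2"
    have t: "t > 0" using \<open>v \<noteq> 0\<close> by (simp add: t_def)
    define u where "u = v /\<^sub>R norm v"
    have u: "norm u = 1" using \<open>v \<noteq> 0\<close> by (simp add: u_def)
    obtain T where T: "det T = 1 + t" "\<And>x. T *v x = x + (t * (u \<bullet> x)) *\<^sub>R u"
      using stretch_matrix[OF u] by blast
    have tu: "t *\<^sub>R u = (1/2) *\<^sub>R v"
      using \<open>v \<noteq> 0\<close> by (simp add: t_def u_def)
    have in_C': "c' + A *v x \<in> C" if "norm x \<le> 1" for x
    proof -
      have "A' *v (transpose S *v x) = A *v x"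
        using S by (simp add: A' matrix_vector_mul_assoc matrix_mul_assoc[symmetric]
            orthogonal_matrix_def del: transpose_matrix_vector)
      then show ?thesis
        using in_C(2)[of "transpose S *v x"] S that
        by (simp add: norm_orthogonal_matrix_mult del: transpose_matrix_vector)
    qed
    have "\<bar>det (A ** T)\<bar> \<le> \<bar>det A\<bar>"
    proof (rule bound)
      fix x :: "real^'n" assume x: "norm x \<le> 1"
      \<comment> \<open>The weight depends on the point: s times the displacement is half of it,
        which gives the midpoint, plus u \<bullet> x halves, which is the stretch. It lies in [0, 1]
        because u and x have norm at most 1.\<close>
      define s where "s = (1 + u \<bullet> x) / 2"
      have "\<bar>u \<bullet> x\<bar> \<le> 1"
        using Cauchy_Schwarz_ineq2[of u x] u x by simp
      then have "(1 - s) *\<^sub>R (c + A *v x) + s *\<^sub>R (c' + A *v x) \<in> C"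
        using x by (intro convexD[OF C] in_C in_C') (auto simp: s_def)
      moreover have "(A ** T) *v x = A *v x + ((u \<bullet> x) / 2) *\<^sub>R (c' - c)"
      proof -
        have "(t * (u \<bullet> x)) *\<^sub>R u = ((u \<bullet> x) / 2) *\<^sub>R v"
          using arg_cong[OF tu, of "\<lambda>z. (u \<bullet> x) *\<^sub>R z"] by (simp add: mult.commute)
        then show ?thesis
          by (simp add: matrix_vector_mul_assoc[symmetric] T matrix_vector_right_distrib
              matrix_vector_mult_scaleR Av)
      qed
      moreover have "(1/2) *\<^sub>R (c + c') + (A *v x + ((u \<bullet> x) / 2) *\<^sub>R (c' - c))
          = (1 - s) *\<^sub>R (c + A *v x) + s *\<^sub>R (c' + A *v x)"
        by (simp add: s_def vec_eq_iff field_simps)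
      ultimately show "(1/2) *\<^sub>R (c + c') + (A ** T) *v x \<in> C" by simp
    qed
    then show False
      using t det by (simp add: det_mul T abs_mult)
  qed
  ultimately show ?thesis using A' that by blast
qed

subsection \<open>Existence and continuity of the maximal ellipsoid\<close>

lemma matrix_inv_inverse:
  fixes A :: "real^'n^'n"
  assumes "det A \<noteq> 0"
  shows "A ** matrix_inv A = mat 1" "matrix_inv A ** A = mat 1"
proof -
  have "\<exists>B. A ** B = mat 1 \<and> B ** A = mat 1"
    using obtain_matrix_inverse[OF assms] by blast
  then have "A ** matrix_inv A = mat 1 \<and> matrix_inv A ** A = mat 1"
    unfolding matrix_inv_def by (rule someI_ex)
  then show "A ** matrix_inv A = mat 1" "matrix_inv A ** A = mat 1" by auto
qed

lemma matrix_inv_mult_vec_iff: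
  fixes A :: "real^'n^'n"
  assumes "det A \<noteq> 0"
  shows "matrix_inv A *v y = x \<longleftrightarrow> A *v x = y"
  using matrix_inv_inverse[OF assms]
  by (metis matrix_vector_mul_assoc matrix_vector_mul_lid)

lemma tendsto_det:
  fixes A :: "'a \<Rightarrow> real^'n^'n"
  assumes "(A \<longlongrightarrow> L) F"
  shows "((\<lambda>x. det (A x)) \<longlongrightarrow> det L) F"
  unfolding det_def by (intro tendsto_intros assms)

lemma tendsto_matrix_vector_mult:
  fixes A :: "'a \<Rightarrow> real^'n^'m"
  assumes "(A \<longlongrightarrow> L) F" "(x \<longlongrightarrow> y) F"
  shows "((\<lambda>a. A a *v x a) \<longlongrightarrow> L *v y) F"
proof (rule vec_tendstoI)
  fix i
  show "((\<lambda>a. (A a *v x a) $ i) \<longlongrightarrow> (L *v y) $ i) F"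
    unfolding matrix_vector_mult_def vec_lambda_beta
    by (intro tendsto_sum tendsto_mult tendsto_vec_nth assms)
qed

text \<open>Cramer's rule expresses the solution by quotients of determinants, which are continuous;
  near an invertible limit all denominators are nonzero.\<close>

lemma tendsto_matrix_inv_mult_vec:
  fixes A :: "'a \<Rightarrow> real^'n^'n"
  assumes A: "(A \<longlongrightarrow> L) F" and x: "(x \<longlongrightarrow> y) F" and det: "det L \<noteq> 0"
  shows "((\<lambda>a. matrix_inv (A a) *v x a) \<longlongrightarrow> matrix_inv L *v y) F"
proof -
  define s where "s B b = (\<chi> k. det (\<chi> i j. if j = k then b $ i else B $ i $ j) / det B)"
    for B :: "real^'n^'n" and b :: "real^'n"
  have s: "matrix_inv B *v b = s B b" if "det B \<noteq> 0" for B b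
    using cramer[OF that] matrix_inv_mult_vec_iff[OF that] unfolding s_def by blast
  have ev: "eventually (\<lambda>a. det (A a) \<noteq> 0) F"
    using tendsto_imp_eventually_ne[OF tendsto_det[OF A] det] .
  have "((\<lambda>a. s (A a) (x a)) \<longlongrightarrow> s L y) F"
    unfolding s_def
  proof (rule vec_tendstoI)
    fix k
    have "((\<lambda>a. (\<chi> i j. if j = k then x a $ i else A a $ i $ j)) \<longlongrightarrow>
        (\<chi> i j. if j = k then y $ i else L $ i $ j)) F"
    proof (intro vec_tendstoI)
      fix i j
      show "((\<lambda>a. (\<chi> i j. if j = k then x a $ i else A a $ i $ j) $ i $ j) \<longlongrightarrow>
        (\<chi> i j. if j = k then y $ i else L $ i $ j) $ i $ j) F"
        by (cases "j = k") (auto intro!: tendsto_intros A x)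
    qed
    from tendsto_divide[OF tendsto_det[OF this] tendsto_det[OF A] det]
    show "((\<lambda>a. (\<chi> k. det (\<chi> i j. if j = k then x a $ i else A a $ i $ j) / det (A a)) $ k)
      \<longlongrightarrow> (\<chi> k. det (\<chi> i j. if j = k then y $ i else L $ i $ j) / det L) $ k) F"
      by simp
  qed
  then have "((\<lambda>a. s (A a) (x a)) \<longlongrightarrow> matrix_inv L *v y) F"
    by (simp add: s[OF det])
  moreover have "\<forall>\<^sub>F a in F. s (A a) (x a) = matrix_inv (A a) *v x a"
    using ev by eventually_elim (simp add: s)
  ultimately show ?thesis
    by (rule Lim_transform_eventually)
qed

text \<open>For invertible A this is the squared gauge of the ellipsoid moved to the origin. Unlike
  A it is determined by the ellipsoid, see \<open>ellipsoid_form_orthogonal_mult\<close>.\<close>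

definition ellipsoid_form :: "real^'n^'n \<Rightarrow> real^'n \<Rightarrow> real" where
  "ellipsoid_form A y = (norm (matrix_inv A *v y))\<^sup>2"

lemma ellipsoid_form_orthogonal_mult:
  fixes A :: "real^'n^'n"
  assumes A: "det A \<noteq> 0" and U: "orthogonal_matrix U"
  shows "ellipsoid_form (A ** U) y = ellipsoid_form A y"
proof -
  have "det (A ** U) \<noteq> 0"
    using A det_orthogonal_matrix[OF U] by (auto simp: det_mul)
  then have "(A ** U) *v (matrix_inv (A ** U) *v y) = y"
    using matrix_inv_mult_vec_iff by blast
  then have "matrix_inv A *v y = U *v (matrix_inv (A ** U) *v y)"
    using matrix_inv_mult_vec_iff[OF A] by (simp add: matrix_vector_mul_assoc matrix_mul_assoc)
  then show ?thesis
    by (simp add: ellipsoid_form_def norm_orthogonal_matrix_mult[OF U])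
qed

text \<open>For nonempty compact sets: Hausdorff distance at most \<delta>.\<close>

definition close_sets :: "real \<Rightarrow> 'a::metric_space set \<Rightarrow> 'a set \<Rightarrow> bool" where
  "close_sets \<delta> C D \<longleftrightarrow> (\<forall>x\<in>C. \<exists>y\<in>D. dist x y \<le> \<delta>) \<and> (\<forall>y\<in>D. \<exists>x\<in>C. dist x y \<le> \<delta>)"

lemma close_sets_refl: "0 \<le> \<delta> \<Longrightarrow> close_sets \<delta> C C"
  unfolding close_sets_def by (auto intro!: bexI)

text \<open>Each column of A is the difference of a point of the ellipsoid and its centre, so every
  entry is at most 2 R; the crude constant counts the entries.\<close>

lemma norm_ellipsoid_matrix_le:
  fixes A :: "real^'n^'n"
  assumes "ellipsoid c A \<subseteq> cball 0 R"
  shows "norm c \<le> R" "norm A \<le> (real CARD('n))\<^sup>2 * (2 * R)"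
proof -
  have R: "norm (c + A *v x) \<le> R" if "norm x \<le> 1" for x
    using assms that by (auto simp: ellipsoid_subset_iff)
  from R[of 0] show c: "norm c \<le> R" by simp
  have comp: "\<bar>A $ i $ j\<bar> \<le> 2 * R" for i j
  proof -
    have "\<bar>A $ i $ j\<bar> \<le> norm (A *v axis j 1)"
      using component_le_norm_cart[of "A *v axis j 1" i] by (simp add: matrix_vector_mul_component inner_axis)
    also have "\<dots> = norm ((c + A *v axis j 1) - c)" by simp
    also have "\<dots> \<le> norm (c + A *v axis j 1) + norm c" by (rule norm_triangle_ineq4)
    also have "\<dots> \<le> 2 * R" using R[of "axis j 1"] c by simp
    finally show ?thesis .
  qed
  have "norm A \<le> (\<Sum>i\<in>UNIV. norm (A $ i))"
    unfolding norm_vec_def by (rule L2_set_le_sum) simp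
  also have "\<dots> \<le> (\<Sum>i\<in>(UNIV::'n set). \<Sum>j\<in>(UNIV::'n set). \<bar>A $ i $ j\<bar>)"
    by (intro sum_mono norm_le_l1_cart)
  also have "\<dots> \<le> (\<Sum>i\<in>(UNIV::'n set). \<Sum>j\<in>(UNIV::'n set). 2 * R)"
    by (intro sum_mono comp)
  finally show "norm A \<le> (real CARD('n))\<^sup>2 * (2 * R)"
    by (simp add: power2_eq_square mult.assoc)
qed

text \<open>The bodies stay within a bounded distance of the compact \<open>D0\<close>, so centres
  and matrices are bounded and a subsequence converges. Each limit point is also a limit of points
  of \<open>D0\<close>, which is closed. With a constant sequence of bodies this yields the
  compactness behind existence.\<close>

lemma ellipsoids_convergent_subsequence:
  fixes A :: "nat \<Rightarrow> real^'n^'n"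
  assumes D0: "compact D0" and e: "e \<longlonglongrightarrow> 0" and close: "\<And>j. close_sets (e j) (D j) D0"
    and sub: "\<And>j. ellipsoid (c j) (A j) \<subseteq> D j"
  obtains r c0 A0 where "strict_mono r" "(c \<circ> r) \<longlonglongrightarrow> c0" "(A \<circ> r) \<longlonglongrightarrow> A0" "ellipsoid c0 A0 \<subseteq> D0"
proof -
  obtain R where R: "\<And>x. x \<in> D0 \<Longrightarrow> norm x \<le> R"
    using compact_imp_bounded[OF D0] by (auto simp: bounded_iff)
  obtain E where E: "\<And>j. e j \<le> E"
    using convergent_imp_Bseq[OF convergentI[OF e]] by (auto simp: Bseq_def abs_le_iff)
  have near: "\<exists>w\<in>D0. dist (c j + A j *v x) w \<le> e j" if "norm x \<le> 1" for j x
    using sub[of j] close[of j] that unfolding ellipsoid_subset_iff close_sets_def by blast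
  have "ellipsoid (c j) (A j) \<subseteq> cball 0 (R + E)" for j
    unfolding ellipsoid_subset_iff
  proof (intro allI impI)
    fix x :: "real^'n" assume "norm x \<le> 1"
    then obtain w where w: "w \<in> D0" "dist (c j + A j *v x) w \<le> e j"
      using near by blast
    have "norm (c j + A j *v x) \<le> norm w + dist (c j + A j *v x) w"
      by (simp add: dist_norm norm_triangle_sub)
    then show "c j + A j *v x \<in> cball 0 (R + E)"
      using w(2) R[OF w(1)] E[of j] by simp
  qed
  note bounds = norm_ellipsoid_matrix_le[OF this]
  have "bounded (range (\<lambda>j. (c j, A j)))"
  proof (rule boundedI)
    fix z assume "z \<in> range (\<lambda>j. (c j, A j))"
    then obtain j where "z = (c j, A j)" by blast
    then show "norm z \<le> (R + E) + (real CARD('n))\<^sup>2 * (2 * (R + E))"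
      using norm_Pair_le[of "c j" "A j"] bounds[of j] by simp
  qed
  then obtain l r where r: "strict_mono r" and l: "((\<lambda>j. (c j, A j)) \<circ> r) \<longlonglongrightarrow> l"
    using bounded_imp_convergent_subsequence by blast
  have c: "(c \<circ> r) \<longlonglongrightarrow> fst l" and A: "(A \<circ> r) \<longlonglongrightarrow> snd l"
    using tendsto_fst[OF l] tendsto_snd[OF l] by (auto simp: o_def)
  have er: "(\<lambda>j. e (r j)) \<longlonglongrightarrow> 0"
    using LIMSEQ_subseq_LIMSEQ[OF e r] by (simp add: o_def)
  have "fst l + snd l *v x \<in> D0" if x: "norm x \<le> 1" for x
  proof -
    have "\<forall>j. \<exists>w. w \<in> D0 \<and> dist (c (r j) + A (r j) *v x) w \<le> e (r j)"
      using near[OF x] by blast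
    then obtain w where w: "\<And>j. w j \<in> D0" "\<And>j. dist (c (r j) + A (r j) *v x) (w j) \<le> e (r j)"
      by metis
    have lim: "(\<lambda>j. c (r j) + A (r j) *v x) \<longlonglongrightarrow> fst l + snd l *v x"
      using c A by (intro tendsto_add tendsto_matrix_vector_mult) (auto simp: o_def)
    have "(\<lambda>j. dist (c (r j) + A (r j) *v x) (w j)) \<longlonglongrightarrow> 0"
      by (rule tendsto_sandwich[OF _ _ tendsto_const er]) (auto simp: w)
    then have "(\<lambda>j. c (r j) + A (r j) *v x - w j) \<longlonglongrightarrow> 0"
      by (simp add: dist_norm tendsto_norm_zero_iff)
    from tendsto_diff[OF lim this] have "w \<longlonglongrightarrow> fst l + snd l *v x" by simp
    then show ?thesis
      using closed_sequentially[OF compact_imp_closed[OF D0]] w(1) by blast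
  qed
  then show ?thesis
    using that[OF r c A] by (simp add: ellipsoid_subset_iff)
qed

text \<open>A small ball inside \<open>D\<close> is a competitor of positive volume.\<close>

lemma det_max_ellipsoid_nonzero:
  fixes A :: "real^'n^'n"
  assumes "interior D \<noteq> {}" "max_ellipsoid D c A"
  shows "det A \<noteq> 0"
proof -
  obtain w \<rho> where w: "\<rho> > 0" "cball w \<rho> \<subseteq> D"
    using assms(1) by (auto simp: mem_interior_cball)
  have "ellipsoid w (\<rho> *\<^sub>R mat 1) \<subseteq> D"
    using w unfolding ellipsoid_subset_iff
    by (auto simp: subset_iff dist_norm scaleR_matrix_vector_assoc[symmetric])
  then have "\<bar>det (\<rho> *\<^sub>R (mat 1 :: real^'n^'n))\<bar> \<le> \<bar>det A\<bar>"
    using assms(2) by (simp add: max_ellipsoid_def)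
  moreover have "\<bar>det (\<rho> *\<^sub>R (mat 1 :: real^'n^'n))\<bar> > 0"
    using w(1) by (simp add: det_scaleR)
  ultimately show ?thesis by auto
qed

lemma max_ellipsoid_exists:
  fixes D :: "(real^'n) set"
  assumes D: "compact D" "D \<noteq> {}"
  obtains c A where "max_ellipsoid D c A"
proof -
  define S where "S = {(c, A). ellipsoid c A \<subseteq> D}"
  obtain w where "w \<in> D" using D by blast
  \<comment> \<open>The degenerate ellipsoid consisting of one point shows that there are
    competitors at all.\<close>
  then have "(w, 0) \<in> S"
    by (simp add: S_def ellipsoid_subset_iff)
  moreover have "compact S"
    unfolding compact_eq_seq_compact_metric seq_compact_def
  proof (intro allI impI)
    fix f assume f: "\<forall>j::nat. f j \<in> S"
    have "ellipsoid (fst (f j)) (snd (f j)) \<subseteq> D" for j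
      using f[rule_format, of j] by (auto simp: S_def)
    then obtain r c0 A0 where r: "strict_mono r" "((\<lambda>j. fst (f j)) \<circ> r) \<longlonglongrightarrow> c0"
      "((\<lambda>j. snd (f j)) \<circ> r) \<longlonglongrightarrow> A0" "ellipsoid c0 A0 \<subseteq> D"
      by (rule ellipsoids_convergent_subsequence[OF D(1) tendsto_const close_sets_refl[OF order_refl]])
    have "(f \<circ> r) \<longlonglongrightarrow> (c0, A0)"
      using tendsto_Pair[OF r(2,3)] by (simp add: o_def)
    then show "\<exists>l\<in>S. \<exists>r. strict_mono r \<and> (f \<circ> r) \<longlonglongrightarrow> l"
      using r by (auto simp: S_def)
  qed
  moreover have "continuous_on S (\<lambda>z. \<bar>det (snd z)\<bar>)"
    unfolding continuous_on_def by (auto intro!: tendsto_intros tendsto_det)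
  ultimately obtain z where "z \<in> S" "\<And>y. y \<in> S \<Longrightarrow> \<bar>det (snd y)\<bar> \<le> \<bar>det (snd z)\<bar>"
    using continuous_attains_sup[of S "\<lambda>z. \<bar>det (snd z)\<bar>"] by blast
  then have "max_ellipsoid D (fst z) (snd z)"
    by (force simp: max_ellipsoid_def S_def)
  then show ?thesis by (rule that)
qed

text \<open>The homothety with centre w and ratio 1 - t leaves room of size t \<rho> inside
  \<open>D0\<close>. If an image point z were outside \<open>D\<close>, a separating hyperplane
  would allow moving z by t \<rho> away from \<open>D\<close> while staying in \<open>D0\<close>,
  too far from \<open>D\<close>.\<close>

lemma shrunk_convex_subset_of_close:
  fixes D :: "'a::euclidean_space set"
  assumes D: "convex D" "closed D" and D0: "convex D0" and ball: "cball w \<rho> \<subseteq> D0" and \<rho>: "0 \<le> \<rho>"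
    and close: "\<And>z. z \<in> D0 \<Longrightarrow> \<exists>d\<in>D. dist d z \<le> t * \<rho>" and t: "0 \<le> t" "t \<le> 1"
    and x: "x \<in> D0"
  shows "(1 - t) *\<^sub>R x + t *\<^sub>R w \<in> D"
proof (rule ccontr)
  define z where "z = (1 - t) *\<^sub>R x + t *\<^sub>R w"
  assume "(1 - t) *\<^sub>R x + t *\<^sub>R w \<notin> D"
  then obtain a b where ab: "a \<bullet> z < b" "\<And>d. d \<in> D \<Longrightarrow> b < a \<bullet> d"
    using separating_hyperplane_closed_point[OF D, of z] by (auto simp: z_def)
  have "a \<noteq> 0"
    using ab close[OF x] by force
  \<comment> \<open>The point of the ball farthest from the side of \<open>D\<close>; mixing it in
    with weight t moves z by t \<rho>.\<close>
  define w' where "w' = w - (\<rho> / norm a) *\<^sub>R a"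
  have "w' \<in> cball w \<rho>"
    using \<rho> \<open>a \<noteq> 0\<close> by (simp add: w'_def dist_norm)
  then have "(1 - t) *\<^sub>R x + t *\<^sub>R w' \<in> D0"
    using ball x t by (intro convexD[OF D0]) auto
  then obtain d where d: "d \<in> D" "norm (d - ((1 - t) *\<^sub>R x + t *\<^sub>R w')) \<le> t * \<rho>"
    using close by (auto simp: dist_norm)
  have "a \<bullet> (d - ((1 - t) *\<^sub>R x + t *\<^sub>R w')) \<le> norm a * (t * \<rho>)"
    using norm_cauchy_schwarz[of a "d - ((1 - t) *\<^sub>R x + t *\<^sub>R w')"] d(2)
    by (meson mult_left_mono norm_ge_zero order_trans)
  moreover have "(1 - t) *\<^sub>R x + t *\<^sub>R w' = z - (t * \<rho> / norm a) *\<^sub>R a"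
    by (simp add: z_def w'_def scaleR_diff_right)
  moreover have "a \<bullet> ((t * \<rho> / norm a) *\<^sub>R a) = norm a * (t * \<rho>)"
    using \<open>a \<noteq> 0\<close> by (simp add: power2_norm_eq_inner[symmetric] power2_eq_square)
  ultimately have "a \<bullet> d \<le> a \<bullet> z"
    by (simp add: inner_diff_right)
  then show False using ab(1) ab(2)[OF d(1)] by linarith
qed

text \<open>An ellipsoid in \<open>D0\<close>, shrunk towards w, fits into \<open>D\<close> by
  \<open>shrunk_convex_subset_of_close\<close>. The shrinking costs the factor (1 - t)^n in the
  determinant.\<close>

lemma det_max_ellipsoid_close_ge:
  fixes A :: "real^'n^'n"
  assumes D: "convex D" "closed D" and D0: "convex D0" and ball: "cball w \<rho> \<subseteq> D0" and \<rho>: "0 \<le> \<rho>"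
    and close: "close_sets (t * \<rho>) D D0" and t: "0 \<le> t" "t \<le> 1"
    and max: "max_ellipsoid D c A" and sub: "ellipsoid c0 A0 \<subseteq> D0"
  shows "(1 - t) ^ CARD('n) * \<bar>det A0\<bar> \<le> \<bar>det A\<bar>"
proof -
  have close': "\<exists>d\<in>D. dist d z \<le> t * \<rho>" if "z \<in> D0" for z
    using close that unfolding close_sets_def by blast
  have "ellipsoid ((1 - t) *\<^sub>R c0 + t *\<^sub>R w) ((1 - t) *\<^sub>R A0) \<subseteq> D"
    unfolding ellipsoid_subset_iff
  proof (intro allI impI)
    fix x :: "real^'n" assume "norm x \<le> 1"
    then have "c0 + A0 *v x \<in> D0" using sub by (simp add: ellipsoid_subset_iff)
    from shrunk_convex_subset_of_close[OF D D0 ball \<rho> close' t this]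
    show "(1 - t) *\<^sub>R c0 + t *\<^sub>R w + ((1 - t) *\<^sub>R A0) *v x \<in> D"
      by (simp add: scaleR_matrix_vector_assoc[symmetric] scaleR_add_right add_ac)
  qed
  then have "\<bar>det ((1 - t) *\<^sub>R A0)\<bar> \<le> \<bar>det A\<bar>"
    using max unfolding max_ellipsoid_def by blast
  then show ?thesis using t by (simp add: det_scaleR abs_mult power_abs)
qed

text \<open>A subsequential limit of the optimal matrices fits into \<open>D0\<close>, and by
  \<open>det_max_ellipsoid_close_ge\<close> its determinant is not smaller than the optimal one. So
  it is optimal and equals \<open>A0\<close> up to a rotation, which the form ignores. The tolerance
  \<rho> / (j + 1) is chosen to make the shrinking parameter 1 / (j + 1).\<close>

lemma ellipsoid_form_continuous_sequentially:
  fixes A :: "nat \<Rightarrow> real^'n^'n"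
  assumes D0: "convex D0" "compact D0" and ball: "cball w \<rho> \<subseteq> D0" and \<rho>: "0 < \<rho>"
    and max0: "max_ellipsoid D0 c0 A0"
    and D: "\<And>j. convex (D j)" "\<And>j. closed (D j)"
    and close: "\<And>j. close_sets (inverse (real (Suc j)) * \<rho>) (D j) D0"
    and max: "\<And>j. max_ellipsoid (D j) (c j) (A j)"
    and y: "y \<longlonglongrightarrow> y0"
  obtains r where "strict_mono r"
    "(\<lambda>j. ellipsoid_form (A (r j)) (y (r j))) \<longlonglongrightarrow> ellipsoid_form A0 y0"
proof -
  have sub: "ellipsoid (c j) (A j) \<subseteq> D j" for j
    using max by (simp add: max_ellipsoid_def)
  have sub0: "ellipsoid c0 A0 \<subseteq> D0"
    using max0 by (simp add: max_ellipsoid_def)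
  have "(\<lambda>j. inverse (real (Suc j)) * \<rho>) \<longlonglongrightarrow> 0"
    using tendsto_mult_right[OF LIMSEQ_inverse_real_of_nat, of \<rho>] by simp
  from ellipsoids_convergent_subsequence[OF D0(2) this close sub]
  obtain r a B where r: "strict_mono r" "(c \<circ> r) \<longlonglongrightarrow> a" "(A \<circ> r) \<longlonglongrightarrow> B" "ellipsoid a B \<subseteq> D0"
    by blast
  have ge: "(1 - inverse (real (Suc (r j)))) ^ CARD('n) * \<bar>det A0\<bar> \<le> \<bar>det (A (r j))\<bar>" for j
    using \<rho> by (intro det_max_ellipsoid_close_ge[OF D D0(1) ball _ close _ _ max sub0])
      (auto simp: inverse_eq_divide)
  have "\<bar>det A0\<bar> \<le> \<bar>det B\<bar>"
  proof (rule LIMSEQ_le)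
    have "(\<lambda>j. inverse (real (Suc (r j)))) \<longlonglongrightarrow> 0"
      using LIMSEQ_subseq_LIMSEQ[OF LIMSEQ_inverse_real_of_nat r(1)] by (simp add: o_def)
    then have "(\<lambda>j. (1 - inverse (real (Suc (r j)))) ^ CARD('n) * \<bar>det A0\<bar>) \<longlonglongrightarrow>
        (1 - 0) ^ CARD('n) * \<bar>det A0\<bar>"
      by (intro tendsto_intros)
    then show "(\<lambda>j. (1 - inverse (real (Suc (r j)))) ^ CARD('n) * \<bar>det A0\<bar>) \<longlonglongrightarrow> \<bar>det A0\<bar>"
      by simp
    show "(\<lambda>j. \<bar>det (A (r j))\<bar>) \<longlonglongrightarrow> \<bar>det B\<bar>"
      using r(3) by (intro tendsto_rabs tendsto_det) (simp add: o_def)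
  qed (use ge in blast)
  then have maxB: "max_ellipsoid D0 a B"
    using max0 r(4) unfolding max_ellipsoid_def by (meson order_trans)
  have "interior D0 \<noteq> {}"
    using ball \<rho> mem_interior_cball by blast
  note det0 = det_max_ellipsoid_nonzero[OF this max0] det_max_ellipsoid_nonzero[OF this maxB]
  obtain U where "orthogonal_matrix U" "B = A0 ** U"
    using max_ellipsoid_unique[OF D0(1) max0 maxB det0(1)] by blast
  then have "ellipsoid_form B y0 = ellipsoid_form A0 y0"
    by (simp add: ellipsoid_form_orthogonal_mult det0(1))
  moreover have "(\<lambda>j. ellipsoid_form (A (r j)) (y (r j))) \<longlonglongrightarrow> ellipsoid_form B y0"
    unfolding ellipsoid_form_def
    using r(3) LIMSEQ_subseq_LIMSEQ[OF y r(1)]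
    by (intro tendsto_power tendsto_norm tendsto_matrix_inv_mult_vec det0(2)) (auto simp: o_def)
  ultimately show ?thesis using that r(1) by simp
qed

text \<open>If all tolerances \<rho> / (j + 1) failed, their counterexamples would form a sequence
  whose forms stay \<epsilon> away from the limit, against the convergent subsequence of
  \<open>ellipsoid_form_continuous_sequentially\<close>.\<close>

lemma ellipsoid_form_continuous:
  fixes A0 :: "real^'n^'n"
  assumes D0: "convex D0" "compact D0" "interior D0 \<noteq> {}"
    and max0: "max_ellipsoid D0 c0 A0" and \<epsilon>: "\<epsilon> > 0"
  obtains \<delta> where "\<delta> > 0"
    "\<And>D c A y. \<lbrakk>convex D; closed D; close_sets \<delta> D D0; max_ellipsoid D c A; dist y y0 \<le> \<delta>\<rbrakk>
      \<Longrightarrow> dist (ellipsoid_form A y) (ellipsoid_form A0 y0) < \<epsilon>"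
proof -
  obtain w \<rho> where \<rho>: "0 < \<rho>" and ball: "cball w \<rho> \<subseteq> D0"
    using D0(3) by (auto simp: mem_interior_cball)
  define good where "good \<delta> \<longleftrightarrow> (\<forall>D c A y. convex D \<and> closed D \<and> close_sets \<delta> D D0 \<and> max_ellipsoid D c A
    \<and> dist y y0 \<le> \<delta> \<longrightarrow> dist (ellipsoid_form A y) (ellipsoid_form A0 y0) < \<epsilon>)" for \<delta>
  have "\<exists>j. good (inverse (real (Suc j)) * \<rho>)"
  proof (rule ccontr)
    assume "\<not> ?thesis"
    then have "\<forall>j. \<exists>D c A y. convex D \<and> closed D \<and> close_sets (inverse (real (Suc j)) * \<rho>) D D0 \<and>
        max_ellipsoid D c A \<and> dist y y0 \<le> inverse (real (Suc j)) * \<rho> \<and>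
        \<not> dist (ellipsoid_form A y) (ellipsoid_form A0 y0) < \<epsilon>"
      unfolding good_def by blast
    then obtain D c A y where *: "\<And>j. convex (D j)" "\<And>j. closed (D j)"
      "\<And>j. close_sets (inverse (real (Suc j)) * \<rho>) (D j) D0" "\<And>j. max_ellipsoid (D j) (c j) (A j)"
      "\<And>j. dist (y j) y0 \<le> inverse (real (Suc j)) * \<rho>"
      "\<And>j. \<not> dist (ellipsoid_form (A j) (y j)) (ellipsoid_form A0 y0) < \<epsilon>"
      by metis
    have lim: "(\<lambda>j. inverse (real (Suc j)) * \<rho>) \<longlonglongrightarrow> 0"
      using tendsto_mult_right[OF LIMSEQ_inverse_real_of_nat, of \<rho>] by simp
    have "(\<lambda>j. dist (y j) y0) \<longlonglongrightarrow> 0"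
      by (rule tendsto_sandwich[OF _ _ tendsto_const lim]) (auto simp: * simp del: of_nat_Suc)
    then have "y \<longlonglongrightarrow> y0" by (subst tendsto_dist_iff)
    from ellipsoid_form_continuous_sequentially[OF D0(1,2) ball \<rho> max0 *(1-4) this]
    obtain r where "(\<lambda>j. ellipsoid_form (A (r j)) (y (r j))) \<longlonglongrightarrow> ellipsoid_form A0 y0"
      by blast
    from tendstoD[OF this \<epsilon>] show False
      using *(6) by simp
  qed
  then show ?thesis
    using \<rho> that unfolding good_def by (metis inverse_positive_iff_positive mult_pos_pos of_nat_0_less_iff zero_less_Suc)
qed

lemma tendsto_ellipsoid_form:
  fixes A0 :: "real^'n^'n" and F :: "'b filter"
  assumes D0: "convex D0" "compact D0" "interior D0 \<noteq> {}"
    and max0: "max_ellipsoid D0 c0 A0"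
    and D: "\<forall>\<^sub>F a in F. convex (D a) \<and> closed (D a) \<and> max_ellipsoid (D a) (c a) (A a)"
    and close: "\<And>\<delta>. \<delta> > 0 \<Longrightarrow> \<forall>\<^sub>F a in F. close_sets \<delta> (D a) D0"
    and y: "(y \<longlongrightarrow> y0) F"
  shows "((\<lambda>a. ellipsoid_form (A a) (y a)) \<longlongrightarrow> ellipsoid_form A0 y0) F"
proof (rule tendstoI)
  fix \<epsilon> :: real assume "\<epsilon> > 0"
  from ellipsoid_form_continuous[OF D0 max0 this]
  obtain \<delta> where \<delta>: "\<delta> > 0" "\<And>D c A y. \<lbrakk>convex D; closed D; close_sets \<delta> D D0; max_ellipsoid D c A; dist y y0 \<le> \<delta>\<rbrakk>
      \<Longrightarrow> dist (ellipsoid_form A y) (ellipsoid_form A0 y0) < \<epsilon>"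
    by blast
  show "\<forall>\<^sub>F a in F. dist (ellipsoid_form (A a) (y a)) (ellipsoid_form A0 y0) < \<epsilon>"
    using D close[OF \<delta>(1)] tendstoD[OF y \<delta>(1)]
    by eventually_elim (use \<delta>(2) in \<open>blast intro: less_imp_le\<close>)
qed

subsection \<open>Volume and coordinates on a subspace\<close>

text \<open>A copy of a finite index type that carries an order: \<open>measure_ellipsoid\<close>
  uses the change of variables formula for well-ordered index types.\<close>

typedef 'a sorted_index = "{..<CARD('a::finite)}"
proof
  show "0 \<in> {..<CARD('a)}" by simp
qed

instantiation sorted_index :: (finite) wellorder
begin

definition less_eq_sorted_index :: "'a sorted_index \<Rightarrow> 'a sorted_index \<Rightarrow> bool" where
  "i \<le> j \<longleftrightarrow> Rep_sorted_index i \<le> Rep_sorted_index j"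
definition less_sorted_index :: "'a sorted_index \<Rightarrow> 'a sorted_index \<Rightarrow> bool" where
  "i < j \<longleftrightarrow> Rep_sorted_index i < Rep_sorted_index j"

instance
proof
  fix P :: "'a sorted_index \<Rightarrow> bool" and a
  assume step: "\<And>x. (\<And>y. y < x \<Longrightarrow> P y) \<Longrightarrow> P x"
  show "P a"
    by (induction a rule: measure_induct_rule[of Rep_sorted_index])
      (rule step, simp add: less_sorted_index_def)
qed (auto simp: less_eq_sorted_index_def less_sorted_index_def Rep_sorted_index_inject)

end

lemma card_sorted_index: "card (UNIV :: 'a::finite sorted_index set) = CARD('a)"
  unfolding type_definition.card[OF type_definition_sorted_index] by simp

instance sorted_index :: (finite) finite
proof
  have "CARD('a sorted_index) > 0"
    by (simp only: card_sorted_index) simp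
  then show "finite (UNIV :: 'a sorted_index set)"
    by (rule card_ge_0_finite)
qed

definition reindex :: "('k \<Rightarrow> 'n) \<Rightarrow> real^'n \<Rightarrow> real^'k" where
  "reindex h x = (\<chi> i. x $ h i)"

lemma linear_reindex: "linear (reindex h)"
  by (intro linearI) (simp_all add: reindex_def vec_eq_iff)

lemma inner_reindex: "bij h \<Longrightarrow> reindex h x \<bullet> reindex h y = x \<bullet> y"
  using sum.reindex_bij_betw[of h UNIV UNIV "\<lambda>j. x $ j * y $ j"]
  by (simp add: reindex_def inner_vec_def)

lemma reindex_reindex: "reindex h (reindex g x) = reindex (g \<circ> h) x"
  by (simp add: reindex_def)

lemma reindex_id: "reindex id x = x"
  by (simp add: reindex_def vec_nth_inverse)

lemma reindex_inverse:
  assumes "bij h"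
  shows "reindex h (reindex (inv h) x) = x" "reindex (inv h) (reindex h y) = y"
proof -
  have "inv h \<circ> h = id" "h \<circ> inv h = id"
    using assms by (simp_all add: bij_is_inj) (metis bij_is_surj surj_iff)
  then show "reindex h (reindex (inv h) x) = x" "reindex (inv h) (reindex h y) = y"
    by (simp_all only: reindex_reindex reindex_id)
qed

lemma vimage_reindex_box:
  assumes "bij h"
  shows "reindex h -` box l u = box (reindex (inv h) l) (reindex (inv h) u)"
proof -
  have "(\<forall>i. l $ i < x $ h i \<and> x $ h i < u $ i) \<longleftrightarrow> (\<forall>j. l $ inv h j < x $ j \<and> x $ j < u $ inv h j)" for x
    using assms by (metis bij_inv_eq_iff)
  then show ?thesis
    by (auto simp: mem_box_cart reindex_def)
qed

lemma prod_Basis_cart: "(\<Prod>b\<in>Basis. z \<bullet> b) = (\<Prod>i\<in>UNIV. z $ i)" for z :: "real^'n"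
proof -
  have Basis: "(Basis :: (real^'n) set) = range (\<lambda>i. axis i 1)"
    by (auto simp: Basis_vec_def)
  have "(\<Prod>b\<in>Basis. z \<bullet> b) = (\<Prod>i\<in>UNIV. z \<bullet> axis i 1)"
    unfolding Basis by (subst prod.reindex) (auto simp: inj_on_def axis_eq_axis)
  then show ?thesis
    by (simp add: inner_axis)
qed

text \<open>Renaming coordinates maps boxes to boxes with the same side lengths, and Lebesgue
  measure is determined by its values on boxes.\<close>

lemma distr_reindex_lborel:
  fixes h :: "'k::finite \<Rightarrow> 'n::finite"
  assumes h: "bij h"
  shows "distr lborel borel (reindex h) = lborel"
proof (rule lborel_eqI[symmetric])
  have meas: "reindex h \<in> borel_measurable lborel"
    using linear_continuous_on[OF linear_conv_bounded_linear[THEN iffD1, OF linear_reindex[of h]]]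
    by (simp add: borel_measurable_continuous_onI)
  fix l u :: "real^'k" assume lu: "\<And>b. b \<in> Basis \<Longrightarrow> l \<bullet> b \<le> u \<bullet> b"
  have le: "l $ i \<le> u $ i" for i
    using lu[of "axis i 1"] by (auto simp: Basis_vec_def inner_axis)
  have "emeasure (distr lborel borel (reindex h)) (box l u)
      = emeasure lborel (box (reindex (inv h) l) (reindex (inv h) u))"
    using meas by (simp add: emeasure_distr vimage_reindex_box[OF h])
  also have "\<dots> = (\<Prod>b\<in>Basis. (reindex (inv h) u - reindex (inv h) l) \<bullet> b)"
    using le by (subst emeasure_lborel_box) (auto simp: Basis_vec_def reindex_def inner_axis)
  also have "(\<Prod>b\<in>Basis. (reindex (inv h) u - reindex (inv h) l) \<bullet> b)
      = (\<Prod>j\<in>UNIV. (u - l) $ inv h j)"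
    by (simp add: prod_Basis_cart reindex_def)
  also have "\<dots> = (\<Prod>i\<in>UNIV. (u - l) $ i)"
    by (rule prod.reindex_bij_betw) (use h bij_imp_bij_inv in blast)
  finally show "emeasure (distr lborel borel (reindex h)) (box l u) = (\<Prod>b\<in>Basis. (u - l) \<bullet> b)"
    by (simp add: prod_Basis_cart)
qed simp

lemma measure_reindex_image:
  fixes h :: "'k::finite \<Rightarrow> 'n::finite"
  assumes h: "bij h" and S: "compact S"
  shows "measure lebesgue (reindex h ` S) = measure lebesgue S"
proof -
  have cont: "continuous_on UNIV (reindex h)"
    using linear_continuous_on[OF linear_conv_bounded_linear[THEN iffD1, OF linear_reindex[of h]]] .
  then have "compact (reindex h ` S)"
    using S by (metis compact_continuous_image continuous_on_subset subset_UNIV)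
  then have borel: "reindex h ` S \<in> sets borel" "S \<in> sets borel"
    using S by (auto intro: borel_compact)
  have "inj (reindex h)"
    using reindex_inverse(2)[OF h] by (metis injI)
  then have "measure lborel S = measure lborel (reindex h -` (reindex h ` S) \<inter> space lborel)"
    by (simp add: inj_vimage_image_eq)
  also have "\<dots> = measure (distr lborel borel (reindex h)) (reindex h ` S)"
    using cont borel by (intro measure_distr[symmetric]) (auto intro: borel_measurable_continuous_onI)
  also have "\<dots> = measure lborel (reindex h ` S)"
    by (simp add: distr_reindex_lborel[OF h])
  finally show ?thesis
    using borel by (simp add: measure_completion)
qed

lemma compact_ellipsoid: "compact (ellipsoid c A)"
  unfolding ellipsoid_def
  by (intro compact_continuous_image continuous_intros matrix_vector_mult_linear_continuous_on compact_cball)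

lemma measure_ellipsoid:
  fixes A :: "real^('n::{finite,wellorder})^('n::{finite,wellorder})"
  shows "measure lebesgue (ellipsoid c A)
    = \<bar>det A\<bar> * measure lebesgue (cball (0 :: real^('n::{finite,wellorder})) 1)"
proof -
  have "ellipsoid c A = (+) c ` ((*v) A ` cball 0 1)"
    by (simp add: ellipsoid_def image_image)
  then show ?thesis
    by (simp add: measure_translation measure_linear_image)
qed

lemma measure_unit_ball_pos: "measure lebesgue (cball 0 1 :: (real^'n) set) > 0"
  using content_cball_pos[of 1 "0 :: real^'n"] by (simp add: measure_completion)

section \<open>Orthonormal coordinates and orthogonal projections\<close>

lemma dot_commute: "dot n x y = dot n y x"
  by (simp add: dot_def mult.commute)

lemma dot_add_right: "dot n x (y + z) = dot n x y + dot n x z"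
  by (simp add: dot_def distrib_left sum.distrib)

lemma dot_diff_right: "dot n x (y - z) = dot n x y - dot n x z"
  by (simp add: dot_def right_diff_distrib sum_subtractf)

lemma dot_scaleR_right: "dot n x (c *\<^sub>R y) = c * dot n x y"
  by (simp add: dot_def sum_distrib_left mult.left_commute)

lemma linear_dot: "linear (dot n x)"
  by (intro linearI) (simp_all add: dot_add_right dot_scaleR_right)

lemma dot_self_pos:
  assumes "x \<in> topspace (Euclidean_space n)" "x \<noteq> 0"
  shows "dot n x x > 0"
proof -
  obtain i where i: "x i \<noteq> 0" using assms(2) by (auto simp: fun_eq_iff)
  then have "i < n" using assms(1) unfolding topspace_Euclidean_space mem_Collect_eq by (meson not_le)
  have "0 < (\<Sum>i<n. x i * x i)"
    by (rule sum_pos2[of _ i]) (use i \<open>i < n\<close> in \<open>auto simp: zero_less_mult_iff linorder_neq_iff\<close>)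
  then show ?thesis by (simp add: dot_def)
qed

definition isometry_onto :: "nat \<Rightarrow> (nat \<Rightarrow> real) set \<Rightarrow> (real^'k \<Rightarrow> nat \<Rightarrow> real) \<Rightarrow> bool" where
  "isometry_onto n V f \<longleftrightarrow> linear f \<and> range f = V \<and> (\<forall>u v. dot n (f u) (f v) = u \<bullet> v)"

text \<open>The adjoint of a linear f, see \<open>inner_adj\<close>. For an isometry onto V it is
  the orthogonal projection onto V, read in the coordinates given by f.\<close>

definition adj :: "nat \<Rightarrow> (real^'k \<Rightarrow> nat \<Rightarrow> real) \<Rightarrow> (nat \<Rightarrow> real) \<Rightarrow> real^'k" where
  "adj n f x = (\<chi> i. dot n (f (axis i 1)) x)"

lemma linear_adj: "linear (adj n f)"
  by (intro linearI) (simp_all add: adj_def vec_eq_iff dot_add_right dot_scaleR_right)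

lemma linear_sum_axis:
  fixes f :: "real^'k \<Rightarrow> 'a::real_vector"
  assumes "linear f"
  shows "f u = (\<Sum>i\<in>UNIV. u $ i *\<^sub>R f (axis i 1))"
proof -
  have "f u = f (\<Sum>i\<in>UNIV. u $ i *\<^sub>R axis i 1)"
    using basis_expansion[of u] by (simp add: scalar_mult_eq_scaleR)
  then show ?thesis
    using assms by (simp add: linear_sum linear_scale)
qed

lemma inner_adj:
  assumes "linear f"
  shows "u \<bullet> adj n f x = dot n (f u) x"
proof -
  have "linear (\<lambda>u. dot n x (f u))"
    using linear_compose[OF assms linear_dot[of n x]] by (simp add: o_def)
  from linear_sum_axis[OF this, of u] show ?thesis
    by (simp add: adj_def inner_vec_def dot_commute)
qed

lemma adj_isometry: "isometry_onto n V f \<Longrightarrow> adj n f (f u) = u"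
  by (simp add: isometry_onto_def adj_def vec_eq_iff inner_axis')

lemma isometry_onto_inj: "isometry_onto n V f \<Longrightarrow> inj f"
  by (metis adj_isometry injI)

lemma isometry_onto_dot_self: "isometry_onto n V f \<Longrightarrow> sqrt (dot n (f u) (f u)) = norm u"
  by (simp add: isometry_onto_def norm_eq_sqrt_inner)

lemma isometry_onto_adj_in:
  assumes "isometry_onto n V f" "x \<in> V"
  shows "f (adj n f x) = x"
proof -
  obtain u where "x = f u"
    using assms by (auto simp: isometry_onto_def)
  then show ?thesis using adj_isometry[OF assms(1)] by simp
qed

text \<open>Tested against f u, the residual x - f a gives the inner product of
  \<open>adj n f x\<close> - a with u, so it is orthogonal to V exactly for a =
  \<open>adj n f x\<close>.\<close>

lemma orth_proj_eq:
  assumes f: "isometry_onto n V f"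
  shows "orth_proj n V x = f (adj n f x)"
  unfolding orth_proj_def
proof (rule the_equality)
  have lin: "linear f" and ran: "range f = V" using f by (auto simp: isometry_onto_def)
  have *: "dot n (x - f a) (f u) = (adj n f x - a) \<bullet> u" for a u
    using inner_adj[OF lin, of u n x] f
    by (simp add: isometry_onto_def dot_commute[of n "x - f a"] dot_diff_right inner_diff_left
        inner_commute[of "adj n f x" u] inner_commute[of u a])
  show "f (adj n f x) \<in> V \<and> (\<forall>w\<in>V. dot n (x - f (adj n f x)) w = 0)"
    using ran * by (auto simp: ran[symmetric])
  fix v assume v: "v \<in> V \<and> (\<forall>w\<in>V. dot n (x - v) w = 0)"
  then obtain a where a: "v = f a" using ran by auto
  have "(adj n f x - a) \<bullet> u = 0" for u
    using v ran *[of a u] by (auto simp: a)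
  then have "adj n f x - a = 0"
    using inner_eq_zero_iff by blast
  then show "v = f (adj n f x)" using a by simp
qed

lemma adj_orth_proj:
  assumes "isometry_onto n V f"
  shows "adj n f (orth_proj n V x) = adj n f x"
  using orth_proj_eq[OF assms] adj_isometry[OF assms] by simp

lemma isometry_onto_compose_reindex:
  fixes f :: "real^'k \<Rightarrow> nat \<Rightarrow> real" and h :: "'k \<Rightarrow> 'n::finite"
  assumes f: "isometry_onto n V f" and h: "bij h"
  shows "isometry_onto n V (f \<circ> reindex h)"
  unfolding isometry_onto_def
proof (intro conjI allI)
  show "linear (f \<circ> reindex h)"
    using f linear_compose[OF linear_reindex] by (auto simp: isometry_onto_def)
  have "surj (reindex h)"
    using reindex_inverse(1)[OF h] by (metis surjI)
  moreover have "range (f \<circ> reindex h) = f ` range (reindex h)"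
    by (rule image_comp[symmetric])
  ultimately show "range (f \<circ> reindex h) = V"
    using f by (simp add: isometry_onto_def)
qed (use f in \<open>simp add: isometry_onto_def inner_reindex[OF h]\<close>)

lemma basis_parametrization:
  fixes V :: "'a::real_vector set"
  assumes V: "subspace V" and dim: "dim V = CARD('k::finite)"
  obtains g :: "real^'k \<Rightarrow> 'a" where "linear g" "range g = V" "\<And>u. g u = 0 \<Longrightarrow> u = 0"
proof -
  obtain B where B: "B \<subseteq> V" "independent B" "V \<subseteq> span B" "card B = dim V"
    by (rule basis_exists)
  have spanB: "span B = V"
    using B V span_minimal by blast
  have finB: "finite B"
    using B(4) dim card.infinite by fastforce
  obtain h where h: "bij_betw h (UNIV :: 'k set) B"
    using finB B(4) dim finite_same_card_bij[of "UNIV :: 'k set" B] by auto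
  define g where "g u = (\<Sum>i\<in>UNIV. u $ i *\<^sub>R h i)" for u :: "real^'k"
  have lin: "linear g"
    by (intro linearI) (simp_all add: g_def scaleR_add_left sum.distrib scaleR_sum_right)
  have sum_B: "(\<Sum>i\<in>UNIV. c (h i) *\<^sub>R h i) = (\<Sum>b\<in>B. c b *\<^sub>R b)" for c
    by (rule sum.reindex_bij_betw[OF h])
  have "range g = V"
  proof
    have "g u \<in> V" for u
      unfolding g_def using h B(1) V by (intro subspace_sum subspace_scale) (auto simp: bij_betw_def)
    then show "range g \<subseteq> V" by blast
    show "V \<subseteq> range g"
    proof
      fix v assume "v \<in> V"
      then obtain c where "v = (\<Sum>b\<in>B. c b *\<^sub>R b)"
        using spanB span_finite[OF finB] by auto
      then have "v = g (\<chi> i. c (h i))"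
        by (simp add: g_def sum_B)
      then show "v \<in> range g" by blast
    qed
  qed
  moreover have "u = 0" if "g u = 0" for u
  proof -
    define c where "c b = u $ inv h b" for b
    have ch: "c (h i) = u $ i" for i
      using h by (simp add: c_def bij_betw_def)
    then have "(\<Sum>b\<in>B. c b *\<^sub>R b) = 0"
      using that sum_B[of c] by (simp add: g_def)
    then have "c b = 0" if "b \<in> B" for b
      using independentD[OF B(2) finB order_refl] that by blast
    then show ?thesis
      using ch h by (auto simp: vec_eq_iff bij_betw_def)
  qed
  ultimately show ?thesis using that lin by blast
qed

text \<open>Symmetric orthonormalization: a linear parametrization of V is precomposed with the
  inverse square root of its Gram matrix. That matrix is positive definite because vectors of V
  vanish from index n on, where \<open>dot n\<close> does not look.\<close>

lemma isometry_onto_exists: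
  assumes V: "V \<in> grassmannian n CARD('k::finite)"
  obtains f :: "real^'k \<Rightarrow> nat \<Rightarrow> real" where "isometry_onto n V f"
proof -
  have V': "subspace V" "dim V = CARD('k)" and Vn: "V \<subseteq> topspace (Euclidean_space n)"
    using V by (auto simp: grassmannian_def)
  obtain g :: "real^'k \<Rightarrow> nat \<Rightarrow> real"
    where g: "linear g" "range g = V" "\<And>u. g u = 0 \<Longrightarrow> u = 0"
    by (rule basis_parametrization[OF V']) blast
  define M :: "real^'k^'k" where "M = (\<chi> i j. dot n (g (axis i 1)) (g (axis j 1)))"
  have M: "u \<bullet> (M *v v) = dot n (g u) (g v)" for u v
  proof -
    have "M *v v = adj n g (g v)"
      using linear_sum_axis[OF linear_compose[OF g(1) linear_dot], of n _ v]
      by (simp add: M_def adj_def vec_eq_iff matrix_vector_mult_def mult.commute)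
    then show ?thesis by (simp add: inner_adj[OF g(1)])
  qed
  have "transpose M = M"
    by (simp add: M_def transpose_def vec_eq_iff dot_commute)
  moreover have "u \<bullet> (M *v u) > 0" if "u \<noteq> 0" for u
    unfolding M using g that Vn by (intro dot_self_pos) auto
  ultimately obtain Q d where Q: "orthogonal_matrix Q" and d: "\<And>i. d i > 0"
    and MP: "M = (Q ** diag_mat d ** transpose Q) ** (Q ** diag_mat d ** transpose Q)"
    by (rule positive_matrix_sqrt) blast+
  define P where "P = Q ** diag_mat d ** transpose Q"
  have symP: "transpose P = P"
    by (simp add: P_def matrix_transpose_mul transpose_diag_mat matrix_mul_assoc)
  have detP: "det P \<noteq> 0"
    using det_orthogonal_matrix[OF Q] d by (auto simp: P_def det_mul det_diag_mat less_le)
  define R where "R = matrix_inv P"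
  have PR: "P *v (R *v u) = u" "R *v (P *v u) = u" for u
    using matrix_inv_inverse[OF detP] by (simp_all add: R_def matrix_vector_mul_assoc)
  have "isometry_onto n V (\<lambda>u. g (R *v u))"
    unfolding isometry_onto_def
  proof (intro conjI allI)
    show "linear (\<lambda>u. g (R *v u))"
      using linear_compose[OF matrix_vector_mul_linear g(1)] by (simp add: o_def)
    have "surj ((*v) R)" using PR(2) by (metis surjI)
    then show "range (\<lambda>u. g (R *v u)) = V"
      using g(2) by (metis image_image)
    fix u v
    have "dot n (g (R *v u)) (g (R *v v)) = (R *v u) \<bullet> (P *v (P *v (R *v v)))"
      by (simp add: M[symmetric] MP P_def matrix_vector_mul_assoc matrix_mul_assoc)
    also have "\<dots> = u \<bullet> v"
      by (simp add: inner_symmetric_matrix[OF symP] PR)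
    finally show "dot n (g (R *v u)) (g (R *v v)) = u \<bullet> v" .
  qed
  then show ?thesis by (rule that)
qed

subsection \<open>John ellipsoids of projections\<close>

text \<open>A map T preserving V becomes the matrix of \<open>adj n f\<close> after T after f, with
  nothing lost since f after \<open>adj n f\<close> is the identity on V. Conversely A is carried to
  a map defined on all sequences, bijective on V.\<close>

lemma ellipsoid_in_iff:
  fixes f :: "real^'n \<Rightarrow> nat \<Rightarrow> real"
  assumes f: "isometry_onto n V f"
  shows "ellipsoid_in n V E \<longleftrightarrow> (\<exists>c (A :: real^'n^'n). det A \<noteq> 0 \<and> E = f ` ellipsoid c A)"
proof -
  have lin: "linear f" and ran: "range f = V" using f by (auto simp: isometry_onto_def)
  have fV: "f u \<in> V" for u using ran by blast
  have "{x \<in> range f. sqrt (dot n x x) \<le> 1} = f ` {u. sqrt (dot n (f u) (f u)) \<le> 1}"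
    by blast
  then have ball: "{x \<in> V. sqrt (dot n x x) \<le> 1} = f ` cball 0 1"
    by (simp only: ran isometry_onto_dot_self[OF f] cball_def dist_0_norm)
  show ?thesis
  proof
    assume "ellipsoid_in n V E"
    then obtain T c where T: "linear T" "bij_betw T V V" and c: "c \<in> V"
      and E: "E = (\<lambda>x. c + T x) ` f ` cball 0 1"
      unfolding ellipsoid_in_def ball by blast
    obtain a where a: "c = f a" using c ran by blast
    define A where "A = matrix (\<lambda>u. adj n f (T (f u)))"
    have "linear (\<lambda>u. adj n f (T (f u)))"
      using linear_compose[OF linear_compose[OF lin T(1)] linear_adj[of n f]] by (simp add: o_def)
    then have A: "A *v u = adj n f (T (f u))" for u
      by (simp add: A_def matrix_works)
    have TV: "T (f u) \<in> V" for u
      using T(2) fV by (auto simp: bij_betw_def)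
    have fA: "f (A *v u) = T (f u)" for u
      by (simp add: A isometry_onto_adj_in[OF f TV])
    have "u = 0" if "A *v u = 0" for u
    proof -
      have "T (f u) = T (f 0)"
        using fA[of u] that linear_0[OF lin] linear_0[OF T(1)] by simp
      then have "f u = f 0"
        using T(2) fV by (meson bij_betw_def inj_onD)
      then show ?thesis
        using isometry_onto_inj[OF f] by (meson injD)
    qed
    then have "det A \<noteq> 0"
      using matrix_left_invertible_ker[of A] by (auto simp: invertible_det_nz[symmetric] invertible_left_inverse)
    moreover have "E = f ` ellipsoid a A"
      by (simp add: E a ellipsoid_def image_image fA linear_add[OF lin])
    ultimately show "\<exists>c (A :: real^'n^'n). det A \<noteq> 0 \<and> E = f ` ellipsoid c A" by blast
  next
    assume "\<exists>c (A :: real^'n^'n). det A \<noteq> 0 \<and> E = f ` ellipsoid c A"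
    then obtain c and A :: "real^'n^'n" where A: "det A \<noteq> 0" and E: "E = f ` ellipsoid c A"
      by blast
    define T where "T x = f (A *v adj n f x)" for x
    define T' where "T' x = f (matrix_inv A *v adj n f x)" for x
    have Tf: "T (f u) = f (A *v u)" "T' (f u) = f (matrix_inv A *v u)" for u
      by (simp_all add: T_def T'_def adj_isometry[OF f])
    have "linear T"
      using linear_compose[OF linear_compose[OF linear_adj[of n f] matrix_vector_mul_linear[of A]] lin]
      by (simp add: T_def[abs_def] o_def)
    moreover have "bij_betw T V V"
      by (rule bij_betwI[of _ _ _ T'])
        (use matrix_inv_inverse[OF A] in \<open>auto simp: ran[symmetric] Tf matrix_vector_mul_assoc\<close>)
    moreover have "E = (\<lambda>x. f c + T x) ` f ` cball 0 1"
      by (simp add: E ellipsoid_def image_image Tf linear_add[OF lin])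
    ultimately show "ellipsoid_in n V E"
      unfolding ellipsoid_in_def ball using fV by blast
  qed
qed

text \<open>The chosen isometry in \<^const>\<open>subspace_volume\<close>, precomposed with a reindexing because the
  change of variables formula of the library requires a well-ordered index type.\<close>

definition frame :: "nat \<Rightarrow> (nat \<Rightarrow> real) set \<Rightarrow> real^('k::finite sorted_index) \<Rightarrow> nat \<Rightarrow> real" where
  "frame n V = (SOME f :: real^'k \<Rightarrow> nat \<Rightarrow> real. isometry_onto n V f)
     \<circ> reindex (SOME h :: 'k \<Rightarrow> 'k sorted_index. bij h)"

lemma bij_sorted_index: "bij (SOME h :: 'k::finite \<Rightarrow> 'k sorted_index. bij h)"
proof -
  have "\<exists>h :: 'k \<Rightarrow> 'k sorted_index. bij h"
    using finite_same_card_bij[of "UNIV :: 'k set" "UNIV :: 'k sorted_index set"]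
    by (simp add: card_sorted_index)
  then show ?thesis by (rule someI_ex)
qed

lemma isometry_onto_some:
  assumes "V \<in> grassmannian n CARD('k::finite)"
  shows "isometry_onto n V (SOME f :: real^'k \<Rightarrow> nat \<Rightarrow> real. isometry_onto n V f)"
  using isometry_onto_exists[OF assms] by (metis someI)

lemma isometry_onto_frame:
  assumes "V \<in> grassmannian n CARD('k::finite)"
  shows "isometry_onto n V (frame n V :: real^('k sorted_index) \<Rightarrow> nat \<Rightarrow> real)"
  unfolding frame_def
  by (rule isometry_onto_compose_reindex[OF isometry_onto_some[OF assms] bij_sorted_index])

text \<open>\<open>frame\<close> contains the very isometry selected in
  \<open>subspace_volume\<close>, so the preimage differs from \<open>S\<close> only by the renaming
  of coordinates and the choice of isometry never has to be discussed.\<close>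

lemma subspace_volume_frame:
  fixes S :: "(real^('k::finite sorted_index)) set"
  assumes V: "V \<in> grassmannian n CARD('k)" and S: "compact S"
  shows "subspace_volume TYPE('k) n V (frame n V ` S) = measure lebesgue S"
proof -
  define f :: "real^'k \<Rightarrow> nat \<Rightarrow> real" where "f = (SOME f. isometry_onto n V f)"
  have f: "isometry_onto n V f"
    unfolding f_def by (rule isometry_onto_some[OF V])
  have image: "frame n V ` S = f ` reindex (SOME h :: 'k \<Rightarrow> 'k sorted_index. bij h) ` S"
    unfolding frame_def f_def[symmetric] by (rule image_comp[symmetric])
  have "subspace_volume TYPE('k) n V (frame n V ` S) = measure lebesgue (f -` frame n V ` S)"
    by (simp add: subspace_volume_def f_def isometry_onto_def)
  also have "f -` frame n V ` S = reindex (SOME h :: 'k \<Rightarrow> 'k sorted_index. bij h) ` S"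
    unfolding image by (rule inj_vimage_image_eq[OF isometry_onto_inj[OF f]])
  finally show ?thesis
    by (simp add: measure_reindex_image[OF bij_sorted_index S])
qed

text \<open>The frame preserves inclusions and multiplies every absolute determinant by the volume
  of the unit ball. Another maximal ellipsoid thus comes from a maximal pair, whose matrix differs
  by a rotation only and so describes the same set.\<close>

lemma john_ellipsoid_frame:
  fixes D :: "(real^('k::finite sorted_index)) set"
  assumes V: "V \<in> grassmannian n CARD('k)" and D: "convex D" "interior D \<noteq> {}"
    and max: "max_ellipsoid D c A"
  shows "john_ellipsoid TYPE('k) n V (frame n V ` D) (frame n V ` ellipsoid c A)"
proof -
  define f :: "real^('k sorted_index) \<Rightarrow> nat \<Rightarrow> real" where "f = frame n V"
  have f: "isometry_onto n V f"
    unfolding f_def by (rule isometry_onto_frame[OF V])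
  have vol: "subspace_volume TYPE('k) n V (f ` ellipsoid c A)
      = \<bar>det A\<bar> * measure lebesgue (cball (0 :: real^('k sorted_index)) 1)" for c A
    unfolding f_def by (simp add: subspace_volume_frame[OF V compact_ellipsoid] measure_ellipsoid)
  have le_iff: "subspace_volume TYPE('k) n V (f ` ellipsoid c A) \<le> subspace_volume TYPE('k) n V (f ` ellipsoid c' A')
      \<longleftrightarrow> \<bar>det A\<bar> \<le> \<bar>det A'\<bar>" for c A c' A'
    unfolding vol by (rule mult_le_cancel_right_pos[OF measure_unit_ball_pos])
  have sub_iff: "f ` S \<subseteq> f ` D \<longleftrightarrow> S \<subseteq> D" for S
    by (rule inj_image_subset_iff[OF isometry_onto_inj[OF f]])
  note detA = det_max_ellipsoid_nonzero[OF D(2) max]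
  have "max_volume_ellipsoid TYPE('k) n V (f ` D) (f ` ellipsoid c A)"
    unfolding max_volume_ellipsoid_def ellipsoid_in_iff[OF f]
    using max detA by (auto simp only: sub_iff le_iff max_ellipsoid_def)
  moreover have "E = f ` ellipsoid c A" if E: "max_volume_ellipsoid TYPE('k) n V (f ` D) E" for E
  proof -
    obtain c' A' where E': "E = f ` ellipsoid c' A'"
      using E unfolding max_volume_ellipsoid_def ellipsoid_in_iff[OF f] by blast
    have "f ` ellipsoid c A \<subseteq> f ` D" "ellipsoid_in n V (f ` ellipsoid c A)"
      using max detA by (auto simp: ellipsoid_in_iff[OF f] max_ellipsoid_def)
    then have "subspace_volume TYPE('k) n V (f ` ellipsoid c A)
        \<le> subspace_volume TYPE('k) n V (f ` ellipsoid c' A')" and "f ` ellipsoid c' A' \<subseteq> f ` D"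
      using E by (simp_all only: max_volume_ellipsoid_def E')
    then have "\<bar>det A\<bar> \<le> \<bar>det A'\<bar>" and "ellipsoid c' A' \<subseteq> D"
      by (simp_all only: le_iff sub_iff)
    then have "max_ellipsoid D c' A'"
      using max unfolding max_ellipsoid_def by (meson order_trans)
    then obtain U where "c' = c" "orthogonal_matrix U" "A' = A ** U"
      by (rule max_ellipsoid_unique[OF D(1) max _ detA])
    then show ?thesis
      by (simp add: E' ellipsoid_orthogonal_mult)
  qed
  ultimately show ?thesis
    unfolding john_ellipsoid_def f_def[symmetric] by blast
qed

section \<open>Projected bodies in coordinates and the topology of the Grassmannian\<close>

lemma convex_body_compact: "convex_body n K \<Longrightarrow> compact K"
  and convex_body_convex: "convex_body n K \<Longrightarrow> convex K"
  and convex_body_topspace: "convex_body n K \<Longrightarrow> K \<subseteq> topspace (Euclidean_space n)"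
  by (auto simp: convex_body_def Euclidean_space_def compactin_subtopology euclidean_product_topology)

lemma continuous_on_adj: "continuous_on S (adj n f)"
proof -
  have "continuous_on UNIV (adj n f)"
    unfolding adj_def dot_def by (intro continuous_intros continuous_on_product_coordinates)
  then show ?thesis by (rule continuous_on_subset) simp
qed

text \<open>Interior points survive the projection: if w is interior to K, then w + f u stays in K
  for small u, and \<open>adj n f\<close> maps these points onto a ball about the image of
  w.\<close>

lemma convex_body_adj_image:
  fixes f :: "real^'k \<Rightarrow> nat \<Rightarrow> real"
  assumes K: "convex_body n K" and f: "isometry_onto n V f" and V: "V \<subseteq> topspace (Euclidean_space n)"
  shows "compact (adj n f ` K)" "convex (adj n f ` K)" "interior (adj n f ` K) \<noteq> {}"
proof -
  show "compact (adj n f ` K)"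
    by (intro compact_continuous_image continuous_on_adj convex_body_compact[OF K])
  show "convex (adj n f ` K)"
    by (intro convex_linear_image linear_adj convex_body_convex[OF K])
  have lin: "linear f" and ran: "range f = V" using f by (auto simp: isometry_onto_def)
  obtain w where w: "w \<in> Euclidean_space n interior_of K"
    using K by (auto simp: convex_body_def)
  have "Euclidean_space n = top_of_set (topspace (Euclidean_space n))"
    by (simp add: Euclidean_space_def euclidean_product_topology)
  then have "openin (top_of_set (topspace (Euclidean_space n))) (Euclidean_space n interior_of K)"
    by (metis openin_interior_of)
  then obtain W where W: "open W" "Euclidean_space n interior_of K = topspace (Euclidean_space n) \<inter> W"
    unfolding openin_open by blast
  have wn: "w \<in> topspace (Euclidean_space n)"
    by (rule subsetD[OF interior_of_subset_topspace w])
  have "linear (\<lambda>u. f u i)" for i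
    using lin by (intro linearI) (simp_all add: linear_add linear_scale)
  then have "continuous_on UNIV (\<lambda>u. w i + f u i)" for i
    by (intro continuous_on_add continuous_on_const linear_continuous_on)
      (simp add: linear_conv_bounded_linear)
  then have cont: "continuous_on UNIV (\<lambda>u. w + f u)"
    by (intro continuous_on_coordinatewise_then_product) simp
  then have op: "open ((\<lambda>u. w + f u) -` W)"
    using W(1) by (simp add: continuous_on_open_vimage)
  have "0 \<in> (\<lambda>u. w + f u) -` W"
    using w W linear_0[OF lin] by auto
  then obtain e where e: "e > 0" "ball 0 e \<subseteq> (\<lambda>u. w + f u) -` W"
    using op open_contains_ball by blast
  have "ball (adj n f w) e \<subseteq> adj n f ` K"
  proof
    fix y assume "y \<in> ball (adj n f w) e"
    then have "y - adj n f w \<in> ball 0 e"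
      by (simp add: dist_norm norm_minus_commute)
    then have "w + f (y - adj n f w) \<in> W" using e by blast
    moreover have "f (y - adj n f w) \<in> topspace (Euclidean_space n)"
      using ran V by blast
    then have "w + f (y - adj n f w) \<in> topspace (Euclidean_space n)"
      using wn by (simp add: topspace_Euclidean_space)
    ultimately have "w + f (y - adj n f w) \<in> K"
      using W interior_of_subset[of "Euclidean_space n" K] by blast
    moreover have "adj n f (w + f (y - adj n f w)) = y"
      by (simp add: linear_add[OF linear_adj] adj_isometry[OF f])
    ultimately show "y \<in> adj n f ` K" by (metis imageI)
  qed
  then have "adj n f w \<in> interior (adj n f ` K)"
    using e(1) by (auto simp: mem_interior)
  then show "interior (adj n f ` K) \<noteq> {}" by blast
qed

text \<open>R multiplies all determinants by the same factor, so it preserves optimality. Together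
  with \<open>ellipsoid_form_matrix_mult\<close> this permits a comparison across different
  frames.\<close>

lemma max_ellipsoid_matrix_image:
  fixes R A :: "real^'n^'n"
  assumes R: "det R \<noteq> 0" and max: "max_ellipsoid D c A"
  shows "max_ellipsoid ((*v) R ` D) (R *v c) (R ** A)"
proof -
  have image: "ellipsoid (B *v a) (B ** M) = (*v) B ` ellipsoid a M" for B M :: "real^'n^'n" and a
    by (simp add: ellipsoid_def image_image matrix_vector_right_distrib matrix_vector_mul_assoc)
  note inv = matrix_inv_inverse[OF R]
  have "\<bar>det A'\<bar> \<le> \<bar>det (R ** A)\<bar>" if "ellipsoid c' A' \<subseteq> (*v) R ` D" for c' A'
  proof -
    have "ellipsoid (matrix_inv R *v c') (matrix_inv R ** A') \<subseteq> (*v) (matrix_inv R) ` (*v) R ` D"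
      unfolding image using that by (rule image_mono)
    also have "\<dots> = D"
      by (simp add: image_image matrix_vector_mul_assoc inv)
    finally have "\<bar>det R\<bar> * \<bar>det (matrix_inv R ** A')\<bar> \<le> \<bar>det R\<bar> * \<bar>det A\<bar>"
      using max by (intro mult_left_mono) (auto simp: max_ellipsoid_def)
    moreover have "R ** (matrix_inv R ** A') = A'"
      by (simp add: matrix_mul_assoc inv)
    then have "\<bar>det R\<bar> * \<bar>det (matrix_inv R ** A')\<bar> = \<bar>det A'\<bar>"
      by (metis abs_mult det_mul)
    ultimately show ?thesis
      by (simp only: det_mul[of R A] abs_mult)
  qed
  moreover have "ellipsoid (R *v c) (R ** A) \<subseteq> (*v) R ` D"
    unfolding image using max by (intro image_mono) (simp add: max_ellipsoid_def)
  ultimately show ?thesis by (simp add: max_ellipsoid_def)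
qed

lemma ellipsoid_form_matrix_mult:
  fixes R A :: "real^'n^'n"
  assumes "det R \<noteq> 0" "det A \<noteq> 0"
  shows "ellipsoid_form (R ** A) (R *v y) = ellipsoid_form A y"
proof -
  have "det (R ** A) \<noteq> 0" using assms by (simp add: det_mul)
  moreover have "(R ** A) *v (matrix_inv A *v y) = R *v y"
    using matrix_inv_inverse[OF assms(2)]
    by (simp add: matrix_vector_mul_assoc[symmetric]) (simp add: matrix_vector_mul_assoc)
  ultimately have "matrix_inv (R ** A) *v (R *v y) = matrix_inv A *v y"
    using matrix_inv_mult_vec_iff by blast
  then show ?thesis by (simp add: ellipsoid_form_def)
qed

lemma tendsto_fun_iff:
  fixes f :: "'a \<Rightarrow> 'b \<Rightarrow> 'c::topological_space"
  shows "(f \<longlongrightarrow> l) F \<longleftrightarrow> (\<forall>i. ((\<lambda>a. f a i) \<longlongrightarrow> l i) F)"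
  using limitin_componentwise[of "\<lambda>_. euclidean" UNIV f l F]
  by (simp add: euclidean_product_topology)

lemma tendsto_adj:
  assumes "\<And>i. ((\<lambda>a. g a i) \<longlongrightarrow> l i) F"
  shows "((\<lambda>a. adj n f (g a)) \<longlongrightarrow> adj n f l) F"
  unfolding adj_def dot_def by (intro tendsto_vec_lambda tendsto_sum tendsto_mult tendsto_const assms)

definition coord :: "nat \<Rightarrow> nat \<Rightarrow> real" where
  "coord j = (\<lambda>i. if i = j then 1 else 0)"

lemma adj_coord_expansion: "adj n f x = (\<Sum>j<n. x j *\<^sub>R adj n f (coord j))"
  by (simp add: vec_eq_iff adj_def dot_def coord_def if_distrib mult.commute cong: if_cong)

lemma compact_coordinates_bounded:
  fixes K :: "(nat \<Rightarrow> real) set"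
  assumes "compact K"
  obtains M where "\<And>x j. \<lbrakk>x \<in> K; j < n\<rbrakk> \<Longrightarrow> \<bar>x j\<bar> \<le> M"
proof -
  have "compact ((\<lambda>x. x j) ` K)" for j
    using assms by (intro compact_continuous_image continuous_on_subset[OF continuous_on_product_coordinates]) auto
  then have "bounded (\<Union>j<n. (\<lambda>x. x j) ` K)"
    by (intro bounded_UN) (auto intro: compact_imp_bounded)
  then show ?thesis
    using that unfolding bounded_iff by (metis UN_I image_eqI lessThan_iff real_norm_def)
qed

lemma topspace_grassmann_topology: "topspace (grassmann_topology n k) = grassmannian n k"
  by (simp add: grassmann_topology_def topspace_pullback_topology)

lemma eventually_atin_topspace: "\<forall>\<^sub>F x in atin X a. x \<in> topspace X"
  by (cases "a \<in> topspace X") (auto simp: eventually_atin intro!: exI[of _ "topspace X"])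

lemma tendsto_orth_proj:
  assumes "V\<^sub>0 \<in> grassmannian n k"
  shows "(orth_proj n \<longlongrightarrow> orth_proj n V\<^sub>0) (atin (grassmann_topology n k) V\<^sub>0)"
proof -
  have "continuous_map (grassmann_topology n k) euclidean (orth_proj n)"
    unfolding grassmann_topology_def
    using continuous_map_pullback[OF continuous_map_id, of "grassmannian n k" "orth_proj n" euclidean]
    by simp
  then show ?thesis
    using assms by (simp add: continuous_map_atin topspace_grassmann_topology)
qed

subsection \<open>The section given by the John ellipsoids\<close>

definition john_matrix :: "nat \<Rightarrow> (nat \<Rightarrow> real) set \<Rightarrow> (real^'n \<Rightarrow> nat \<Rightarrow> real) \<Rightarrow> real^'n^'n" where
  "john_matrix n K f = (SOME A. \<exists>c. max_ellipsoid (adj n f ` K) c A)"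

text \<open>The centre is forgotten and only the shape is kept. The matrix is selected separately
  for each V and may jump by rotations; the form does not.\<close>

definition john_section ::
    "nat \<Rightarrow> ((nat \<Rightarrow> real) set \<Rightarrow> real^'n \<Rightarrow> nat \<Rightarrow> real) \<Rightarrow> (nat \<Rightarrow> real) set \<Rightarrow>
     (nat \<Rightarrow> real) set \<Rightarrow> (nat \<Rightarrow> real) \<Rightarrow> real" where
  "john_section n fr K V = (\<lambda>x\<in>V. ellipsoid_form (john_matrix n K (fr V)) (adj n (fr V) x))"

lemma john_matrix:
  assumes "convex_body n K" "isometry_onto n V f" "V \<subseteq> topspace (Euclidean_space n)"
  obtains c where "max_ellipsoid (adj n f ` K) c (john_matrix n K f)" "det (john_matrix n K f) \<noteq> 0"
proof -
  note D = convex_body_adj_image[OF assms]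
  have "adj n f ` K \<noteq> {}" using D(3) by auto
  with D(1) have "\<exists>A c. max_ellipsoid (adj n f ` K) c A"
    by (rule max_ellipsoid_exists) blast
  then have "\<exists>c. max_ellipsoid (adj n f ` K) c (john_matrix n K f)"
    unfolding john_matrix_def by (rule someI_ex)
  then show ?thesis
    using that det_max_ellipsoid_nonzero[OF D(3)] by blast
qed

lemma john_section_quadratic_form: "john_section n fr K V \<in> quadratic_forms V"
proof -
  define L where "L x = matrix_inv (john_matrix n K (fr V)) *v adj n (fr V) x" for x
  have L: "linear L"
    using linear_compose[OF linear_adj[of n "fr V"] matrix_vector_mul_linear[of "matrix_inv (john_matrix n K (fr V))"]]
    by (simp add: L_def[abs_def] o_def)
  have "bilinear (\<lambda>x y. L x \<bullet> L y)"
    unfolding bilinear_def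
    by (intro conjI allI linearI)
      (simp_all add: linear_add[OF L] linear_scale[OF L] inner_add_left inner_add_right)
  moreover have "john_section n fr K V x = L x \<bullet> L x" if "x \<in> V" for x
    using that by (simp add: john_section_def ellipsoid_form_def L_def power2_norm_eq_inner)
  ultimately show ?thesis
    unfolding quadratic_forms_def
    by (auto simp: john_section_def inner_commute intro!: exI[of _ "\<lambda>x y. L x \<bullet> L y"])
qed

lemma matrix_transition:
  fixes f f' :: "real^'n \<Rightarrow> nat \<Rightarrow> real"
  assumes "linear f"
  shows "matrix (\<lambda>u. adj n f' (f u)) *v u = adj n f' (f u)"
  using linear_compose[OF assms linear_adj[of n f']] by (simp add: o_def matrix_works)

lemma transpose_matrix_transition:
  fixes f f' :: "real^'n \<Rightarrow> nat \<Rightarrow> real"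
  assumes f: "linear f" and f': "linear f'"
  shows "transpose (matrix (\<lambda>u. adj n f' (f u))) *v w = adj n f (f' w)"
proof -
  let ?R = "matrix (\<lambda>u. adj n f' (f u))"
  have "u \<bullet> (transpose ?R *v w) = u \<bullet> adj n f (f' w)" for u
  proof -
    have "u \<bullet> (transpose ?R *v w) = w \<bullet> (?R *v u)"
      using dot_lmul_matrix[of w ?R u] by (simp add: inner_commute)
    also have "\<dots> = dot n (f u) (f' w)"
      by (simp add: matrix_transition[OF f] inner_adj[OF f'] dot_commute)
    finally show ?thesis by (simp add: inner_adj[OF f])
  qed
  then show ?thesis using vector_eq_ldot by blast
qed

text \<open>The transition matrix R itself need not converge, because the frames are arbitrary. But
  R times its transpose is the projector onto V compressed to the coordinates of
  \<open>V\<^sub>0\<close>; there the frame of V cancels, and the product tends to the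
  identity.\<close>

lemma eventually_det_transition_nonzero:
  fixes fr :: "(nat \<Rightarrow> real) set \<Rightarrow> real^'n \<Rightarrow> nat \<Rightarrow> real"
  assumes fr: "\<And>V. V \<in> grassmannian n k \<Longrightarrow> isometry_onto n V (fr V)"
    and V\<^sub>0: "V\<^sub>0 \<in> grassmannian n k"
    and lim: "\<And>x. ((\<lambda>V. adj n (fr V\<^sub>0) (orth_proj n V x)) \<longlongrightarrow> adj n (fr V\<^sub>0) x) F"
    and ev: "\<forall>\<^sub>F V in F. V \<in> grassmannian n k"
  shows "\<forall>\<^sub>F V in F. det (matrix (\<lambda>u. adj n (fr V\<^sub>0) (fr V u))) \<noteq> 0"
proof -
  define f where "f = fr V\<^sub>0"
  define R where "R V = matrix (\<lambda>u. adj n f (fr V u))" for V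
  define M where "M V = R V ** transpose (R V)" for V
  have f: "isometry_onto n V\<^sub>0 f" unfolding f_def by (rule fr[OF V\<^sub>0])
  have M: "adj n f (orth_proj n V (f w)) = M V *v w" if "V \<in> grassmannian n k" for V w
  proof -
    note iso = fr[OF that]
    have lin: "linear (fr V)" "linear f" using iso f by (auto simp: isometry_onto_def)
    show ?thesis
      by (simp add: M_def matrix_vector_mul_assoc[symmetric] R_def transpose_matrix_transition[OF lin]
          matrix_transition[OF lin(1)] orth_proj_eq[OF iso] del: transpose_matrix_vector)
  qed
  have "(M \<longlongrightarrow> mat 1) F"
  proof (intro vec_tendstoI)
    fix i j
    have "((\<lambda>V. adj n f (orth_proj n V (f (axis j 1))) $ i) \<longlongrightarrow> adj n f (f (axis j 1)) $ i) F"
      unfolding f_def by (intro tendsto_vec_nth lim)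
    moreover have "\<forall>\<^sub>F V in F. adj n f (orth_proj n V (f (axis j 1))) $ i = M V $ i $ j"
      using ev by eventually_elim (simp add: M matrix_vector_mul_component inner_axis)
    ultimately have "((\<lambda>V. M V $ i $ j) \<longlongrightarrow> adj n f (f (axis j 1)) $ i) F"
      by (rule Lim_transform_eventually)
    then show "((\<lambda>V. M V $ i $ j) \<longlongrightarrow> mat 1 $ i $ j) F"
      by (simp add: adj_isometry[OF f] axis_def mat_def)
  qed
  from tendsto_det[OF this] have "((\<lambda>V. det (M V)) \<longlongrightarrow> 1) F" by simp
  from tendsto_imp_eventually_ne[OF this, of 0] have "\<forall>\<^sub>F V in F. det (M V) \<noteq> 0" by simp
  then show ?thesis
    by eventually_elim (simp add: M_def R_def f_def det_mul)
qed

text \<open>The maps are determined by their values on n coordinate vectors, and the coordinates are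
  bounded on the compact K. Convergence at these finitely many vectors is therefore uniform on
  K.\<close>

lemma eventually_close_sets_images:
  fixes K :: "(nat \<Rightarrow> real) set" and p :: "'a \<Rightarrow> (nat \<Rightarrow> real) \<Rightarrow> real^'n"
  assumes K: "compact K" and \<delta>: "\<delta> > 0"
    and exp: "\<forall>\<^sub>F a in F. \<forall>x. p a x = (\<Sum>j<n. x j *\<^sub>R p a (coord j))"
    and exp0: "\<And>x. q x = (\<Sum>j<n. x j *\<^sub>R q (coord j))"
    and lim: "\<And>j. ((\<lambda>a. p a (coord j)) \<longlongrightarrow> q (coord j)) F"
  shows "\<forall>\<^sub>F a in F. close_sets \<delta> (p a ` K) (q ` K)"
proof -
  obtain M where M: "\<And>x j. \<lbrakk>x \<in> K; j < n\<rbrakk> \<Longrightarrow> \<bar>x j\<bar> \<le> M"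
    using compact_coordinates_bounded[OF K] by blast
  have "((\<lambda>a. \<Sum>j<n. M * norm (p a (coord j) - q (coord j))) \<longlongrightarrow>
      (\<Sum>j<n. M * norm (q (coord j) - q (coord j)))) F"
    by (intro tendsto_sum tendsto_mult tendsto_const tendsto_norm tendsto_diff lim)
  then have "((\<lambda>a. \<Sum>j<n. M * norm (p a (coord j) - q (coord j))) \<longlongrightarrow> 0) F"
    by simp
  from order_tendstoD(2)[OF this \<delta>] exp
  show ?thesis
  proof eventually_elim
    case (elim a)
    have "dist (p a x) (q x) \<le> \<delta>" if "x \<in> K" for x
    proof -
      have "p a x - q x = (\<Sum>j<n. x j *\<^sub>R (p a (coord j) - q (coord j)))"
        using elim(2)[rule_format, of x] exp0[of x]
        by (simp only: scaleR_diff_right sum_subtractf)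
      then have "norm (p a x - q x) \<le> (\<Sum>j<n. norm (x j *\<^sub>R (p a (coord j) - q (coord j))))"
        by (simp only: norm_sum)
      also have "\<dots> \<le> (\<Sum>j<n. M * norm (p a (coord j) - q (coord j)))"
        using M that by (intro sum_mono) (auto intro: mult_right_mono)
      finally show ?thesis
        using elim(1) by (simp add: dist_norm)
    qed
    then show ?case by (auto simp: close_sets_def)
  qed
qed

text \<open>Near \<open>V\<^sub>0\<close> the projected bodies are transported to one fixed space by the adjoint of the frame
  of \<open>V\<^sub>0\<close>. This differs from the transport by the frame of \<open>V\<close> by a linear isomorphism, which the form
  of the maximal ellipsoid does not notice; so no continuity of the frames is needed.\<close>

lemma tendsto_john_section:
  fixes fr :: "(nat \<Rightarrow> real) set \<Rightarrow> real^'n \<Rightarrow> nat \<Rightarrow> real"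
  assumes fr: "\<And>V. V \<in> grassmannian n k \<Longrightarrow> isometry_onto n V (fr V)"
    and K: "convex_body n K" and V\<^sub>0: "V\<^sub>0 \<in> grassmannian n k"
  shows "((\<lambda>V. john_section n fr K V (orth_proj n V x)) \<longlongrightarrow> john_section n fr K V\<^sub>0 (orth_proj n V\<^sub>0 x))
    (atin (grassmann_topology n k) V\<^sub>0)"
proof -
  define F where "F = atin (grassmann_topology n k) V\<^sub>0"
  define f where "f = fr V\<^sub>0"
  define R where "R V = matrix (\<lambda>u. adj n f (fr V u))" for V
  define A where "A V = john_matrix n K (fr V)" for V
  have f: "isometry_onto n V\<^sub>0 f" unfolding f_def by (rule fr[OF V\<^sub>0])
  have ev: "\<forall>\<^sub>F V in F. V \<in> grassmannian n k"
    using eventually_atin_topspace[of "grassmann_topology n k" V\<^sub>0]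
    by (simp add: F_def topspace_grassmann_topology)
  have lim: "((\<lambda>V. adj n f (orth_proj n V x)) \<longlongrightarrow> adj n f x) F" for x
    using tendsto_orth_proj[OF V\<^sub>0] tendsto_adj[of "\<lambda>V. orth_proj n V x" "orth_proj n V\<^sub>0 x" F n f]
    by (simp add: F_def tendsto_fun_iff adj_orth_proj[OF f])
  have R: "R V *v adj n (fr V) x = adj n f (orth_proj n V x)" if "V \<in> grassmannian n k" for V x
    using fr[OF that] by (simp add: R_def matrix_transition isometry_onto_def orth_proj_eq[OF fr[OF that]])
  have detR: "\<forall>\<^sub>F V in F. det (R V) \<noteq> 0"
    unfolding R_def f_def
    using fr V\<^sub>0 lim[unfolded f_def] ev by (rule eventually_det_transition_nonzero)
  have proj: "john_section n fr K V (orth_proj n V x) = ellipsoid_form (A V) (adj n (fr V) x)"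
    if "V \<in> grassmannian n k" for V
  proof -
    note iso = fr[OF that]
    have "orth_proj n V x \<in> V"
      using iso by (auto simp: orth_proj_eq[OF iso] isometry_onto_def)
    then show ?thesis
      by (simp add: john_section_def A_def adj_orth_proj[OF iso])
  qed
  have sub: "V \<subseteq> topspace (Euclidean_space n)" if "V \<in> grassmannian n k" for V
    using that by (simp add: grassmannian_def)
  have "\<exists>c. max_ellipsoid (adj n (fr V) ` K) c (A V) \<and> det (A V) \<noteq> 0" if "V \<in> grassmannian n k" for V
    using john_matrix[OF K fr[OF that] sub[OF that]] unfolding A_def by blast
  then obtain c where c: "\<And>V. V \<in> grassmannian n k \<Longrightarrow> max_ellipsoid (adj n (fr V) ` K) (c V) (A V)"
    "\<And>V. V \<in> grassmannian n k \<Longrightarrow> det (A V) \<noteq> 0"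
    by metis
  \<comment> \<open>By \<open>R\<close> this is the image under \<open>adj n f\<close> of the
    projection of K onto V, in which \<open>fr V\<close> no longer occurs.\<close>
  define D where "D V = (*v) (R V) ` adj n (fr V) ` K" for V
  have D: "\<forall>\<^sub>F V in F. convex (D V) \<and> closed (D V) \<and> max_ellipsoid (D V) (R V *v c V) (R V ** A V)"
    using ev detR
  proof eventually_elim
    case (elim V)
    note body = convex_body_adj_image[OF K fr[OF elim(1)] sub[OF elim(1)]]
    have "compact (D V)"
      unfolding D_def by (intro compact_continuous_image matrix_vector_mult_linear_continuous_on body)
    moreover have "convex (D V)"
      unfolding D_def by (intro convex_linear_image matrix_vector_mul_linear body)
    moreover have "max_ellipsoid (D V) (R V *v c V) (R V ** A V)"
      unfolding D_def by (rule max_ellipsoid_matrix_image[OF elim(2) c(1)[OF elim(1)]])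
    ultimately show ?case by (simp add: compact_imp_closed)
  qed
  have close: "\<forall>\<^sub>F V in F. close_sets \<delta> (D V) (adj n f ` K)" if "\<delta> > 0" for \<delta>
  proof -
    define p where "p V x = R V *v adj n (fr V) x" for V x
    have p: "\<forall>\<^sub>F V in F. adj n f (orth_proj n V x) = p V x" for x
      using ev by eventually_elim (simp add: p_def R)
    have "p V x = (\<Sum>j<n. x j *\<^sub>R p V (coord j))" for V x
      unfolding p_def
      by (subst adj_coord_expansion)
        (simp add: linear_sum[OF matrix_vector_mul_linear] matrix_vector_mult_scaleR)
    then have "\<forall>\<^sub>F V in F. \<forall>x. p V x = (\<Sum>j<n. x j *\<^sub>R p V (coord j))"
      by (intro always_eventually allI)
    moreover have "((\<lambda>V. p V (coord j)) \<longlongrightarrow> adj n f (coord j)) F" for j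
      using Lim_transform_eventually[OF lim p] .
    ultimately have "\<forall>\<^sub>F V in F. close_sets \<delta> (p V ` K) (adj n f ` K)"
      by (rule eventually_close_sets_images[where q = "adj n f" and n = n,
            OF convex_body_compact[OF K] that _ adj_coord_expansion])
    then show ?thesis
      by (simp add: D_def p_def image_image)
  qed
  note body0 = convex_body_adj_image[OF K f sub[OF V\<^sub>0]]
  have max0: "max_ellipsoid (adj n f ` K) (c V\<^sub>0) (A V\<^sub>0)"
    using c(1)[OF V\<^sub>0] by (simp add: f_def)
  have "((\<lambda>V. ellipsoid_form (R V ** A V) (adj n f (orth_proj n V x))) \<longlongrightarrow> ellipsoid_form (A V\<^sub>0) (adj n f x)) F"
    by (rule tendsto_ellipsoid_form[OF body0(2,1,3) max0 D close lim])
  moreover have "\<forall>\<^sub>F V in F. ellipsoid_form (R V ** A V) (adj n f (orth_proj n V x))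
      = john_section n fr K V (orth_proj n V x)"
    using ev detR
    by eventually_elim (simp add: proj R[symmetric] ellipsoid_form_matrix_mult c(2))
  ultimately show ?thesis
    unfolding proj[OF V\<^sub>0] F_def[symmetric] f_def[symmetric] by (rule Lim_transform_eventually)
qed

text \<open>The total space has a pullback topology and function spaces have pointwise convergence,
  so continuity splits into that of the projectors and, for each fixed x, that of the pulled-back
  form.\<close>

lemma continuous_john_section:
  fixes fr :: "(nat \<Rightarrow> real) set \<Rightarrow> real^'n \<Rightarrow> nat \<Rightarrow> real"
  assumes fr: "\<And>V. V \<in> grassmannian n k \<Longrightarrow> isometry_onto n V (fr V)"
    and K: "convex_body n K"
  shows "continuous_section n k (john_section n fr K)"
  unfolding continuous_section_def sym_square_bundle_def
proof (rule continuous_map_pullback')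
  let ?X = "grassmann_topology n k" and ?s = "john_section n fr K"
  have "((\<lambda>V. (orth_proj n V, ?s V \<circ> orth_proj n V)) \<longlongrightarrow> (orth_proj n V\<^sub>0, ?s V\<^sub>0 \<circ> orth_proj n V\<^sub>0)) (atin ?X V\<^sub>0)"
    if "V\<^sub>0 \<in> grassmannian n k" for V\<^sub>0
  proof (rule tendsto_Pair)
    show "(orth_proj n \<longlongrightarrow> orth_proj n V\<^sub>0) (atin ?X V\<^sub>0)"
      by (rule tendsto_orth_proj[OF that])
    show "((\<lambda>V. ?s V \<circ> orth_proj n V) \<longlongrightarrow> ?s V\<^sub>0 \<circ> orth_proj n V\<^sub>0) (atin ?X V\<^sub>0)"
      unfolding tendsto_fun_iff o_apply using tendsto_john_section[OF fr K that] by blast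
  qed
  then show "continuous_map ?X euclidean ((\<lambda>(V, q). (orth_proj n V, q \<circ> orth_proj n V)) \<circ> (\<lambda>V. (V, ?s V)))"
    by (simp add: continuous_map_atin topspace_grassmann_topology o_def)
  show "topspace ?X \<subseteq> (\<lambda>V. (V, ?s V)) -` (SIGMA V:grassmannian n k. quadratic_forms V)"
    by (auto simp: topspace_grassmann_topology john_section_quadratic_form)
qed

section \<open>From proportional forms to balls\<close>

lemma std_form_isometry:
  assumes "isometry_onto n V f"
  shows "std_form n V (f u) = (norm u)\<^sup>2"
proof -
  have "(\<Sum>i<n. (f u i)\<^sup>2) = dot n (f u) (f u)"
    by (simp add: dot_def power2_eq_square)
  then show ?thesis
    using assms by (auto simp: std_form_def isometry_onto_def power2_norm_eq_inner)
qed

text \<open>Membership of y means that the form at y - c is at most 1, that is, r |y - c|^2 \<le> 1.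
  The sign of r is not assumed: the form of an invertible matrix is positive at a unit vector, and r
  is its value there.\<close>

lemma ellipsoid_eq_cball:
  fixes A :: "real^'n^'n"
  assumes A: "det A \<noteq> 0" and form: "\<And>u. ellipsoid_form A u = r * (norm u)\<^sup>2"
  shows "r > 0" "ellipsoid c A = cball c (1 / sqrt r)"
proof -
  obtain u :: "real^'n" where u: "norm u = 1" using vector_choose_size[of 1] by auto
  have "A *v (matrix_inv A *v u) = u"
    using matrix_inv_mult_vec_iff[OF A] by blast
  then have "matrix_inv A *v u \<noteq> 0" using u by auto
  moreover have "r = (norm (matrix_inv A *v u))\<^sup>2"
    using form[of u] u by (simp add: ellipsoid_form_def)
  ultimately show r: "r > 0" by simp
  have "y \<in> ellipsoid c A \<longleftrightarrow> y \<in> cball c (1 / sqrt r)" for y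
  proof -
    have "y \<in> ellipsoid c A \<longleftrightarrow> (\<exists>x. norm x \<le> 1 \<and> A *v x = y - c)"
      by (auto simp: ellipsoid_def algebra_simps)
    also have "\<dots> \<longleftrightarrow> norm (matrix_inv A *v (y - c)) \<le> 1"
      using matrix_inv_mult_vec_iff[OF A] by metis
    also have "\<dots> \<longleftrightarrow> r * (norm (y - c))\<^sup>2 \<le> 1"
      by (simp add: form[symmetric] ellipsoid_form_def abs_square_le_1)
    also have "\<dots> \<longleftrightarrow> (sqrt r * norm (y - c))\<^sup>2 \<le> 1"
      using r by (simp add: power_mult_distrib)
    also have "\<dots> \<longleftrightarrow> norm (y - c) \<le> 1 / sqrt r"
      unfolding abs_square_le_1 using r by (simp add: abs_mult pos_le_divide_eq mult.commute)
    finally show ?thesis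
      by (simp add: dist_norm norm_minus_commute)
  qed
  then show "ellipsoid c A = cball c (1 / sqrt r)" by blast
qed

lemma euclidean_ball_in_isometry:
  assumes f: "isometry_onto n V f" and r: "r > 0"
  shows "euclidean_ball_in n V (f ` cball c r)"
proof -
  have lin: "linear f" and ran: "range f = V" using f by (auto simp: isometry_onto_def)
  have "sqrt (dot n (f u - f c) (f u - f c)) = dist c u" for u
    using isometry_onto_dot_self[OF f, of "u - c"]
    by (simp add: linear_diff[OF lin] dist_norm norm_minus_commute)
  moreover have "{x \<in> range f. P x} = f ` {u. P (f u)}" for P by blast
  ultimately have "f ` cball c r = {x \<in> V. sqrt (dot n (x - f c) (x - f c)) \<le> r}"
    by (simp only: ran[symmetric] cball_def)
  then show ?thesis
    unfolding euclidean_ball_in_def using r ran by blast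
qed

theorem corollary8:
  fixes p \<alpha> k m N n :: nat
    and K :: "nat \<Rightarrow> (nat \<Rightarrow> real) set"
  assumes "prime p" and "k = 2 * p ^ \<alpha>" and "CARD('k::finite) = k"
    and "m \<ge> 1"
    and "N > 0" and "section_bound k m N"
    and "n \<ge> N"
    and "\<And>i. i \<in> {1..m} \<Longrightarrow> convex_body n (K i)"
  shows "\<exists>L\<in>grassmannian n k. \<forall>i\<in>{1..m}.
           \<exists>E. euclidean_ball_in n L E \<and> john_ellipsoid TYPE('k) n L (orth_proj n L ` K i) E"
proof -
  \<comment> \<open>The same frames enter \<open>john_ellipsoid_frame\<close>, so the matrix behind
    the section is also the one whose ellipsoid is recognised as the John ellipsoid.\<close>
  let ?fr = "frame n :: _ \<Rightarrow> real^('k sorted_index) \<Rightarrow> _"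
  have fr: "isometry_onto n V (?fr V)" if "V \<in> grassmannian n k" for V
    using isometry_onto_frame that assms(3) by blast
  have "\<forall>i\<in>{1..m}. continuous_section n k (john_section n ?fr (K i))"
    using continuous_john_section[of n k ?fr, OF fr assms(8)] by blast
  then obtain V where V: "V \<in> grassmannian n k"
    and form: "\<forall>i\<in>{1..m}. \<exists>r. \<forall>x\<in>V. john_section n ?fr (K i) V x = r * std_form n V x"
    using assms(6)[unfolded section_bound_def, rule_format, OF assms(7), of "\<lambda>i. john_section n ?fr (K i)"]
    by blast
  define f where "f = ?fr V"
  have f: "isometry_onto n V f" unfolding f_def by (rule fr[OF V])
  have sub: "V \<subseteq> topspace (Euclidean_space n)" using V by (simp add: grassmannian_def)
  have "\<exists>E. euclidean_ball_in n V E \<and> john_ellipsoid TYPE('k) n V (orth_proj n V ` K i) E"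
    if i: "i \<in> {1..m}" for i
  proof -
    note K = assms(8)[OF i]
    note body = convex_body_adj_image[OF K f sub]
    obtain c where max: "max_ellipsoid (adj n f ` K i) c (john_matrix n (K i) f)"
      and det: "det (john_matrix n (K i) f) \<noteq> 0"
      by (rule john_matrix[OF K f sub])
    obtain r where r: "\<And>x. x \<in> V \<Longrightarrow> john_section n ?fr (K i) V x = r * std_form n V x"
      using form i by blast
    \<comment> \<open>Evaluating the proportionality on V at f u turns it into a statement about all
      coordinate vectors u.\<close>
    have "ellipsoid_form (john_matrix n (K i) f) u = r * (norm u)\<^sup>2" for u
    proof -
      have "f u \<in> V" using f by (auto simp: isometry_onto_def)
      from r[OF this] this show ?thesis
        by (simp add: john_section_def f_def[symmetric] adj_isometry[OF f] std_form_isometry[OF f])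
    qed
    note ball = ellipsoid_eq_cball[OF det this]
    have "euclidean_ball_in n V (f ` ellipsoid c (john_matrix n (K i) f))"
      unfolding ball(2) by (rule euclidean_ball_in_isometry[OF f]) (use ball(1) in simp)
    moreover have "orth_proj n V ` K i = f ` adj n f ` K i"
      by (simp add: image_image orth_proj_eq[OF f])
    moreover have "john_ellipsoid TYPE('k) n V (f ` adj n f ` K i) (f ` ellipsoid c (john_matrix n (K i) f))"
      unfolding f_def
      by (rule john_ellipsoid_frame) (use V assms(3) body(2,3) max in \<open>simp_all add: f_def\<close>)
    ultimately show ?thesis by metis
  qed
  with V show ?thesis by blast
qed

end
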